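(* Let $\rho\in\mathbb Q_{>0}$ with $\rho^{-1}\in\mathbb N$. Let $V$ be an associative unital vertex algebra, $S\subset V$ a subset with a map $S\to\rho\mathbb N$, $a\mapsto h_a$, and $F^S$ the increasing invariant filtration generated by $S$. (i) Suppose that $S$ generates $V$ (as a unital vertex algebra) and $[a_\lambda b]\in F^S_{h_a+h_b-\rho}[\lambda]$ for any $a,b\in S$. Then $S$ generates the differential algebra $V_*$ with the PBW-property. (ii) Suppose that $V$ is $\rho\mathbb N$-graded, that $S$ is a graded subset (every $a\in S$ is homogeneous) with $h_a$ the weight of $a$, and that $S$ generates the differential algebra $V_*$. Then $F^S=F^{si}$ is the standard invariant filtration, and the assumptions of (i) are satisfied.
   Context: Conventions: $\mathbb K$ is a field of characteristic $0$. All vector spaces are super ($\mathbb Z/2$-graded), multiplications are even, $\zeta^{ab}=(-1)^{p(a)p(b)}$. $x^{(n)}=x^n/n!$. A vertex algebra is a (not necessarily associative) algebra $V$ with an even derivation $T$ and an even linear map $V\otimes V\to V[\lambda]$, $[a_\lambda b]=\sum_{t\ge0}a_tb\lambda^{(t)}$, with $T[a_\lambda b]=[Ta_\lambda b]+[a_\lambda Tb]$ and $[Ta_\lambda b]=-\lambda[a_\lambda b]$. $V_*$ is the underlying algebra with derivation $T$. Put $a_{-1-t}b=(T^{(t)}a)b$ for $t\ge0$. Unital: the algebra has an identity $1$. It is associative if: (1) $[a,b]c=a(bc)-\zeta^{ab}b(ac)$ where $[a,b]=ab-\zeta^{ab}ba$; (2) $[[a_\lambda b]_\mu c]=[a_\lambda[b_{\mu-\lambda}c]]-\zeta^{ab}[b_{\mu-\lambda}[a_\lambda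 c]]$; (3) $[a_\lambda b]=-\zeta^{ab}[b_{-\lambda-T}a]$ where $[b_{-\lambda-T}a]=\sum_t(-\lambda-T)^{(t)}(b_ta)$; (4) $[a,b]=\sum_{i\ge0}(-1)^iT^{(i+1)}(a_ib)$; (5) $[a_\lambda bc]=[a_\lambda b]c+\zeta^{ab}b[a_\lambda c]+\int_0^\lambda d\mu\,[[a_\lambda b]_\mu c]$. A $\rho\mathbb N$-grading is $V=\bigoplus_{h\in\rho\mathbb N} V_h$ with $TV_h\subset V_{h+1}$ and $(V_h)_tV_k\subset V_{h+k-t-1}$ for all $t\in\mathbb Z$ (with $V_h=0$ for $h\notin\rho\mathbb N$). An increasing invariant filtration is a family of subspaces $(F_n)_{n\in\rho\mathbb Z}$ with $F_n\subset F_{n+\rho}$, $1\in F_0$, and $(F_n)_kF_m\subset F_{n+m}$ for all $k\in\mathbb Z$. The one generated by $S$ is the smallest such filtration $F^S$ with $a\in F^S_{h_a}$ for all $a\in S$. For graded $V$, the standard invariant filtration $F^{si}$ is the smallest increasing invariant filtration with $V_h\subset F^{si}_h$ for all $h$. $S$ generates $V_*$ if $V$ is the smallest subspace containing $S$ and $1$ and closed under the product and $T$. $S$ generates $V_*$ with the PBW-property if, for any total order on $S\times\mathbb N$, $V$ is the span of the products $T^{n_1}(a_1)\cdots T^{n_r}(a_r)$ with $a_i\in S$, $n_i\ge 0$, $r\ge0$, $(a_1,n_1)\ge\cdots\ge(a_r,n_r)$ (the empty product being $1$), where products are bracketed to the right: $b_1b_2\cdots b_r=b_1(b_2(\cdots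 b_r))$.
   Formalization: S is assumed to consist of parity-homogeneous (even or odd) elements; without this (i) fails, e.g. for S={x+η, ξ, x−η} in K[x]⊗Λ(ξ,η) with T=0 and zero bracket. *)

theory Defs
  imports Complex_Main "HOL-Computational_Algebra.Polynomial"
begin

section \<open>Vertex algebras\<close>

text \<open>
  The underlying vector space is the whole type \<open>'v\<close>. \<open>parity V False\<close> and \<open>parity V True\<close> are its
  even and odd part, \<open>der V\<close> is the derivation \<open>T\<close>, and \<open>lbr V a b\<close> is the \<open>\<lambda>\<close>-bracket
  \<open>[a\<^sub>\<lambda> b]\<close>, an element of \<open>V[\<lambda>]\<close>, i.e. a polynomial with coefficients in \<open>'v\<close>.
\<close>

record (overloaded) ('k, 'v) valg =
  parity :: "bool \<Rightarrow> 'v set"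
  scl :: "'k \<Rightarrow> 'v \<Rightarrow> 'v"  (infixr "\<odot>\<index>" 75)
  mul :: "'v \<Rightarrow> 'v \<Rightarrow> 'v"  (infixr "\<cdot>\<index>" 70)
  der :: "'v \<Rightarrow> 'v"
  lbr :: "'v \<Rightarrow> 'v \<Rightarrow> 'v poly"
  vunit :: "'v"  ("\<one>\<index>")

abbreviation vsubspace :: "('k::field_char_0, 'v::ab_group_add) valg \<Rightarrow> 'v set \<Rightarrow> bool" where
  "vsubspace V \<equiv> module.subspace (scl V)"

abbreviation vspan :: "('k::field_char_0, 'v::ab_group_add) valg \<Rightarrow> 'v set \<Rightarrow> 'v set" where
  "vspan V \<equiv> module.span (scl V)"

abbreviation vlinear :: "('k::field_char_0, 'v::ab_group_add) valg \<Rightarrow> ('v \<Rightarrow> 'v) \<Rightarrow> bool" where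
  "vlinear V \<equiv> Vector_Spaces.linear (scl V) (scl V)"

text \<open>Scalar multiplication on \<open>V[\<lambda>]\<close>.\<close>

definition pscl :: "('k::field_char_0, 'v::ab_group_add) valg \<Rightarrow> 'k \<Rightarrow> 'v poly \<Rightarrow> 'v poly" where
  "pscl V c = map_poly (scl V c)"

locale vertex_algebra = vector_space "scl V"
  for V :: "('k::field_char_0, 'v::ab_group_add) valg" (structure) +
  assumes parity_subspace: "subspace (parity V p)"
    and parity_Int: "parity V False \<inter> parity V True = {0}"
    and parity_sum: "\<exists>x\<in>parity V False. \<exists>y\<in>parity V True. v = x + y"
    and mul_linear_right: "vlinear V (\<lambda>b. a \<cdot> b)"
    and mul_linear_left: "vlinear V (\<lambda>a. a \<cdot> b)"
    and mul_even: "a \<in> parity V p \<Longrightarrow> b \<in> parity V q \<Longrightarrow> a \<cdot> b \<in> parity V (p \<noteq> q)"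
    and der_linear: "vlinear V (der V)"
    and der_even: "a \<in> parity V p \<Longrightarrow> der V a \<in> parity V p"
    and der_mul: "der V (a \<cdot> b) = der V a \<cdot> b + a \<cdot> der V b"
    and lbr_linear_right: "Vector_Spaces.linear (scl V) (pscl V) (\<lambda>b. lbr V a b)"
    and lbr_linear_left: "Vector_Spaces.linear (scl V) (pscl V) (\<lambda>a. lbr V a b)"
    and lbr_even:
      "a \<in> parity V p \<Longrightarrow> b \<in> parity V q \<Longrightarrow> coeff (lbr V a b) t \<in> parity V (p \<noteq> q)"
    and der_lbr: "map_poly (der V) (lbr V a b) = lbr V (der V a) b + lbr V a (der V b)"
    and lbr_der: "lbr V (der V a) b = - pCons 0 (lbr V a b)"

text \<open>\<open>nprod V a t b\<close> is \<open>a\<^sub>t b\<close> for \<open>t \<ge> 0\<close>; the factorial accounts for \<open>\<lambda>\<^sup>t/t!\<close>.\<close>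

definition nprod :: "('k::field_char_0, 'v::ab_group_add) valg \<Rightarrow> 'v \<Rightarrow> nat \<Rightarrow> 'v \<Rightarrow> 'v" where
  "nprod V a t b = fact t \<odot>\<^bsub>V\<^esub> coeff (lbr V a b) t"

text \<open>The divided power \<open>T\<^sup>n/n!\<close>.\<close>

definition dder :: "('k::field_char_0, 'v::ab_group_add) valg \<Rightarrow> nat \<Rightarrow> 'v \<Rightarrow> 'v" where
  "dder V n a = inverse (fact n) \<odot>\<^bsub>V\<^esub> (der V ^^ n) a"

definition zprod :: "('k::field_char_0, 'v::ab_group_add) valg \<Rightarrow> 'v \<Rightarrow> int \<Rightarrow> 'v \<Rightarrow> 'v" where
  "zprod V a k b =
     (if 0 \<le> k then nprod V a (nat k) b else dder V (nat (- 1 - k)) a \<cdot>\<^bsub>V\<^esub> b)"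

section \<open>Associativity and unit\<close>

text \<open>\<open>zeta p q\<close> is the sign \<open>\<zeta>\<^sup>a\<^sup>b\<close> for \<open>a\<close> of parity \<open>p\<close> and \<open>b\<close> of parity \<open>q\<close>.\<close>

definition zeta :: "bool \<Rightarrow> bool \<Rightarrow> 'k::field_char_0" where
  "zeta p q = (if p \<and> q then - 1 else 1)"

text \<open>The supercommutator of \<open>a\<close> of parity \<open>p\<close> and \<open>b\<close> of parity \<open>q\<close>.\<close>

definition scomm ::
  "('k::field_char_0, 'v::ab_group_add) valg \<Rightarrow> bool \<Rightarrow> bool \<Rightarrow> 'v \<Rightarrow> 'v \<Rightarrow> 'v" where
  "scomm V p q a b = a \<cdot>\<^bsub>V\<^esub> b - zeta p q \<odot>\<^bsub>V\<^esub> (b \<cdot>\<^bsub>V\<^esub> a)"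

text \<open>
  \<open>psubst X f p\<close> is obtained from \<open>p = (\<Sum>t. p\<^sub>t \<lambda>\<^sup>t)\<close> by applying \<open>f\<close> to the coefficients and
  substituting the operator \<open>X\<close> for \<open>\<lambda>\<close>: it is \<open>\<Sum>t. X\<^sup>t (f p\<^sub>t)\<close>.
\<close>

definition psubst :: "('m \<Rightarrow> 'm) \<Rightarrow> ('v::zero \<Rightarrow> 'm::comm_monoid_add) \<Rightarrow> 'v poly \<Rightarrow> 'm" where
  "psubst X f p = (\<Sum>t\<le>degree p. (X ^^ t) (f (coeff p t)))"

text \<open>
  \<open>V[\<lambda>,\<mu>]\<close> is \<open>'v poly poly\<close> with inner variable \<open>\<lambda>\<close> and outer variable \<open>\<mu>\<close>. The operators
  of multiplication by \<open>\<lambda>\<close> and \<open>\<mu>\<close>: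
\<close>

definition times_lam :: "'v::ab_group_add poly poly \<Rightarrow> 'v poly poly" where
  "times_lam = map_poly (pCons 0)"

definition times_mu :: "'v::ab_group_add poly poly \<Rightarrow> 'v poly poly" where
  "times_mu = pCons 0"

text \<open>\<open>[[a\<^sub>\<lambda> b]\<^sub>\<mu> c]\<close>\<close>

definition lbr_lam_mu ::
  "('k::field_char_0, 'v::ab_group_add) valg \<Rightarrow> 'v \<Rightarrow> 'v \<Rightarrow> 'v \<Rightarrow> 'v poly poly" where
  "lbr_lam_mu V a b c = psubst times_lam (\<lambda>v. map_poly (\<lambda>w. [:w:]) (lbr V v c)) (lbr V a b)"

text \<open>\<open>[a\<^sub>\<lambda> [b\<^sub>\<mu>\<^sub>-\<^sub>\<lambda> c]]\<close>\<close>

definition lbr_lam_diff ::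
  "('k::field_char_0, 'v::ab_group_add) valg \<Rightarrow> 'v \<Rightarrow> 'v \<Rightarrow> 'v \<Rightarrow> 'v poly poly" where
  "lbr_lam_diff V a b c =
     psubst (\<lambda>f. times_mu f - times_lam f) (\<lambda>v. [:lbr V a v:]) (lbr V b c)"

text \<open>\<open>[b\<^sub>\<mu>\<^sub>-\<^sub>\<lambda> [a\<^sub>\<lambda> c]]\<close>\<close>

definition lbr_diff_lam ::
  "('k::field_char_0, 'v::ab_group_add) valg \<Rightarrow> 'v \<Rightarrow> 'v \<Rightarrow> 'v \<Rightarrow> 'v poly poly" where
  "lbr_diff_lam V b a c =
     psubst times_lam
       (\<lambda>v. psubst (\<lambda>f. times_mu f - times_lam f) (\<lambda>w. [:[:w:]:]) (lbr V b v))
       (lbr V a c)"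

text \<open>\<open>[b\<^bsub>-\<lambda>-T\<^esub> a]\<close>\<close>

definition lbr_skew :: "('k::field_char_0, 'v::ab_group_add) valg \<Rightarrow> 'v \<Rightarrow> 'v \<Rightarrow> 'v poly" where
  "lbr_skew V b a =
     psubst (\<lambda>f. - pCons 0 f - map_poly (der V) f) (\<lambda>v. [:v:]) (lbr V b a)"

text \<open>
  The formal integral \<open>\<integral>\<^sub>0\<^sup>\<lambda> d\<mu> f(\<lambda>,\<mu>)\<close>, mapping \<open>g(\<lambda>) \<mu>\<^sup>s\<close> to
  \<open>g(\<lambda>) \<lambda>\<^bsup>s+1\<^esup>/(s+1)\<close>.
\<close>

definition int_mu :: "('k::field_char_0, 'v::ab_group_add) valg \<Rightarrow> 'v poly poly \<Rightarrow> 'v poly" where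
  "int_mu V f =
     (\<Sum>s\<le>degree f. (pCons 0 ^^ Suc s) (pscl V (inverse (of_nat (Suc s))) (coeff f s)))"

locale assoc_unital_vertex_algebra = vertex_algebra V
  for V :: "('k::field_char_0, 'v::ab_group_add) valg" (structure) +
  assumes unit_left: "\<one> \<cdot> a = a"
    and unit_right: "a \<cdot> \<one> = a"
    and comm_mul:
      "a \<in> parity V p \<Longrightarrow> b \<in> parity V q \<Longrightarrow>
       scomm V p q a b \<cdot> c = a \<cdot> (b \<cdot> c) - zeta p q \<odot> (b \<cdot> (a \<cdot> c))"
    and jacobi:
      "a \<in> parity V p \<Longrightarrow> b \<in> parity V q \<Longrightarrow>
       lbr_lam_mu V a b c =
         lbr_lam_diff V a b c - map_poly (pscl V (zeta p q)) (lbr_diff_lam V b a c)"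
    and skew_symmetry:
      "a \<in> parity V p \<Longrightarrow> b \<in> parity V q \<Longrightarrow>
       lbr V a b = - pscl V (zeta p q) (lbr_skew V b a)"
    and commutator:
      "a \<in> parity V p \<Longrightarrow> b \<in> parity V q \<Longrightarrow>
       scomm V p q a b =
         (\<Sum>i\<le>degree (lbr V a b). (- 1) ^ i \<odot> dder V (Suc i) (nprod V a i b))"
    and wick:
      "a \<in> parity V p \<Longrightarrow> b \<in> parity V q \<Longrightarrow>
       lbr V a (b \<cdot> c) =
         map_poly (\<lambda>v. v \<cdot> c) (lbr V a b)
         + pscl V (zeta p q) (map_poly (\<lambda>v. b \<cdot> v) (lbr V a c))
         + int_mu V (lbr_lam_mu V a b c)"

section \<open>Gradings and filtrations\<close>

definition rhoN :: "rat \<Rightarrow> rat set" where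
  "rhoN \<rho> = range (\<lambda>n::nat. \<rho> * of_nat n)"

definition rhoZ :: "rat \<Rightarrow> rat set" where
  "rhoZ \<rho> = range (\<lambda>n::int. \<rho> * of_int n)"

definition graded ::
  "('k::field_char_0, 'v::ab_group_add) valg \<Rightarrow> rat \<Rightarrow> (rat \<Rightarrow> 'v set) \<Rightarrow> bool" where
  "graded V \<rho> G \<longleftrightarrow>
     (\<forall>h. vsubspace V (G h)) \<and>
     (\<forall>h. \<forall>v\<in>G h. \<exists>x\<in>G h \<inter> parity V False. \<exists>y\<in>G h \<inter> parity V True. v = x + y) \<and>
     (\<forall>h. h \<notin> rhoN \<rho> \<longrightarrow> G h = {0}) \<and>
     (\<forall>v. \<exists>!f. (\<forall>h. f h \<in> G h) \<and> finite {h. f h \<noteq> 0} \<and> v = (\<Sum>h | f h \<noteq> 0. f h)) \<and>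
     (\<forall>h. \<forall>a\<in>G h. der V a \<in> G (h + 1)) \<and>
     (\<forall>h k. \<forall>a\<in>G h. \<forall>b\<in>G k. \<forall>t::int. zprod V a t b \<in> G (h + k - of_int t - 1))"

text \<open>Only the values \<open>F n\<close> with \<open>n \<in> rhoZ \<rho>\<close> are meaningful.\<close>

definition inv_filtration ::
  "('k::field_char_0, 'v::ab_group_add) valg \<Rightarrow> rat \<Rightarrow> (rat \<Rightarrow> 'v set) \<Rightarrow> bool" where
  "inv_filtration V \<rho> F \<longleftrightarrow>
     (\<forall>n\<in>rhoZ \<rho>. vsubspace V (F n)) \<and>
     (\<forall>n\<in>rhoZ \<rho>. F n \<subseteq> F (n + \<rho>)) \<and>
     \<one>\<^bsub>V\<^esub> \<in> F 0 \<and>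
     (\<forall>n\<in>rhoZ \<rho>. \<forall>m\<in>rhoZ \<rho>. \<forall>a\<in>F n. \<forall>b\<in>F m. \<forall>k::int. zprod V a k b \<in> F (n + m))"

text \<open>
  The intersection is again an invariant filtration (\<open>inv_filtration_smallest\<close>). The conditions used
  for \<open>C\<close> below only bound \<open>F\<close> from below, so it satisfies \<open>C\<close> and is the smallest such.
\<close>

definition smallest_filtration ::
  "('k::field_char_0, 'v::ab_group_add) valg \<Rightarrow> rat \<Rightarrow> ((rat \<Rightarrow> 'v set) \<Rightarrow> bool) \<Rightarrow> rat \<Rightarrow> 'v set"
  where "smallest_filtration V \<rho> C n = \<Inter> {F n | F. inv_filtration V \<rho> F \<and> C F}"

definition generated_filtration ::
  "('k::field_char_0, 'v::ab_group_add) valg \<Rightarrow> rat \<Rightarrow> 'v set \<Rightarrow> ('v \<Rightarrow> rat) \<Rightarrow> rat \<Rightarrow> 'v set" where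
  "generated_filtration V \<rho> S h = smallest_filtration V \<rho> (\<lambda>F. \<forall>a\<in>S. a \<in> F (h a))"

definition standard_filtration ::
  "('k::field_char_0, 'v::ab_group_add) valg \<Rightarrow> rat \<Rightarrow> (rat \<Rightarrow> 'v set) \<Rightarrow> rat \<Rightarrow> 'v set" where
  "standard_filtration V \<rho> G = smallest_filtration V \<rho> (\<lambda>F. \<forall>h\<in>rhoN \<rho>. G h \<subseteq> F h)"

lemma inv_filtration_smallest:
  assumes "vertex_algebra V"
  shows "inv_filtration V \<rho> (smallest_filtration V \<rho> C)"
proof -
  interpret vertex_algebra V by fact
  have mem: "x \<in> smallest_filtration V \<rho> C n \<longleftrightarrow> (\<forall>F. inv_filtration V \<rho> F \<and> C F \<longrightarrow> x \<in> F n)"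
    for x n
    by (auto simp: smallest_filtration_def)
  show ?thesis
    unfolding inv_filtration_def[of V \<rho> "smallest_filtration V \<rho> C"]
  proof (intro conjI ballI allI subsetI)
    fix n assume "n \<in> rhoZ \<rho>"
    then show "subspace (smallest_filtration V \<rho> C n)"
      unfolding smallest_filtration_def inv_filtration_def
      by (intro subspace_Inter) auto
  qed (unfold mem, auto simp: inv_filtration_def)
qed

section \<open>Generation\<close>

definition generates_vertex_algebra ::
  "('k::field_char_0, 'v::ab_group_add) valg \<Rightarrow> 'v set \<Rightarrow> bool" where
  "generates_vertex_algebra V S \<longleftrightarrow>
     (\<forall>W. vsubspace V W \<and> S \<subseteq> W \<and> \<one>\<^bsub>V\<^esub> \<in> W \<and> (\<forall>a\<in>W. der V a \<in> W) \<and>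
          (\<forall>a\<in>W. \<forall>b\<in>W. a \<cdot>\<^bsub>V\<^esub> b \<in> W) \<and> (\<forall>a\<in>W. \<forall>b\<in>W. \<forall>t. nprod V a t b \<in> W)
        \<longrightarrow> W = UNIV)"

definition generates_diff_algebra ::
  "('k::field_char_0, 'v::ab_group_add) valg \<Rightarrow> 'v set \<Rightarrow> bool" where
  "generates_diff_algebra V S \<longleftrightarrow>
     (\<forall>W. vsubspace V W \<and> S \<subseteq> W \<and> \<one>\<^bsub>V\<^esub> \<in> W \<and> (\<forall>a\<in>W. der V a \<in> W) \<and>
          (\<forall>a\<in>W. \<forall>b\<in>W. a \<cdot>\<^bsub>V\<^esub> b \<in> W)
        \<longrightarrow> W = UNIV)"

text \<open>
  The product of \<open>(a\<^sub>1,n\<^sub>1), \<dots>, (a\<^sub>r,n\<^sub>r)\<close>, bracketed to the right; the trailing factor \<open>\<one>\<close> added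
  by \<open>foldr\<close> changes nothing, as \<open>b \<cdot> \<one> = b\<close>.
\<close>

definition der_monomial ::
  "('k::field_char_0, 'v::ab_group_add) valg \<Rightarrow> ('v \<times> nat) list \<Rightarrow> 'v" where
  "der_monomial V xs = foldr (\<lambda>(a, n) w. (der V ^^ n) a \<cdot>\<^bsub>V\<^esub> w) xs \<one>\<^bsub>V\<^esub>"

text \<open>\<open>(x, y) \<in> r\<close> means \<open>x \<le> y\<close>, so the lists below are weakly decreasing.\<close>

definition generates_PBW :: "('k::field_char_0, 'v::ab_group_add) valg \<Rightarrow> 'v set \<Rightarrow> bool" where
  "generates_PBW V S \<longleftrightarrow>
     (\<forall>r. linear_order_on (S \<times> UNIV) r \<longrightarrow>
        vspan V {der_monomial V xs | xs.
          set xs \<subseteq> S \<times> UNIV \<and> sorted_wrt (\<lambda>x y. (y, x) \<in> r) xs} = UNIV)"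

definition filtered_generators ::
  "('k::field_char_0, 'v::ab_group_add) valg \<Rightarrow> rat \<Rightarrow> 'v set \<Rightarrow> ('v \<Rightarrow> rat) \<Rightarrow> bool" where
  "filtered_generators V \<rho> S h \<longleftrightarrow>
     generates_vertex_algebra V S \<and>
     (\<forall>a\<in>S. \<forall>b\<in>S. \<forall>t.
        coeff (lbr V a b) t \<in> generated_filtration V \<rho> S h (h a + h b - \<rho>))"

end

theory Submission
  imports Defs
begin

text \<open>
  For (i), bracketing two right-normed monomials in the \<open>T\<^sup>n a\<close> with \<open>a \<in> S\<close> lowers the filtration
  degree, by the Wick formula on the right and skew-symmetry on the left. Commutators are
  combinations of derivatives of bracket coefficients, and the associator is a combination of
  commutators:
  \<open>(ab)c - a(bc) = [ab,c] \<plusminus> [c,a]b \<plusminus> a[c,b]\<close>. Hence, modulo terms of degree \<open>n - 1\<close>, monomials multiply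
  associatively and their factors may be permuted. Let \<open>E n\<close> be the span of the monomials of weight
  at most \<open>n\<close>. If \<open>F m \<subseteq> E m\<close> for all \<open>m < n\<close>, then replacing \<open>F m\<close> by \<open>F m \<inter> E m\<close> for \<open>m \<le> n\<close> yields
  an invariant filtration, so minimality of \<open>F\<close> gives \<open>F n \<subseteq> E n\<close>. The induction starts because
  \<open>F n = 0\<close> for \<open>n < 0\<close>.

  For (ii), differential monomials in homogeneous generators of weight \<open>q\<close> lie in \<open>F q\<close>, which
  gives \<open>V\<^sub>q \<subseteq> F q\<close>, and the bracket lowers the weight by at least \<open>1 \<ge> \<rho>\<close>.
\<close>

section \<open>Linearity of the operations and subspaces stable under them\<close>

context vertex_algebra
begin

lemma mul_add_right: "a \<cdot> (b + c) = a \<cdot> b + a \<cdot> c"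
  and mul_scl_right: "a \<cdot> (k \<odot> b) = k \<odot> (a \<cdot> b)"
  and mul_zero_right [simp]: "a \<cdot> 0 = 0"
proof -
  interpret l: Vector_Spaces.linear "scl V" "scl V" "\<lambda>b. a \<cdot> b" by (rule mul_linear_right)
  show "a \<cdot> (b + c) = a \<cdot> b + a \<cdot> c" "a \<cdot> (k \<odot> b) = k \<odot> (a \<cdot> b)" "a \<cdot> 0 = 0"
    by (rule l.add l.scale l.zero)+
qed

lemma mul_add_left: "(a + b) \<cdot> c = a \<cdot> c + b \<cdot> c"
  and mul_scl_left: "(k \<odot> a) \<cdot> b = k \<odot> (a \<cdot> b)"
  and mul_zero_left [simp]: "0 \<cdot> b = 0"
proof -
  interpret l: Vector_Spaces.linear "scl V" "scl V" "\<lambda>a. a \<cdot> b" for b by (rule mul_linear_left)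
  show "(a + b) \<cdot> c = a \<cdot> c + b \<cdot> c" "(k \<odot> a) \<cdot> b = k \<odot> (a \<cdot> b)" "0 \<cdot> b = 0"
    by (rule l.add l.scale l.zero)+
qed

lemma der_add: "der V (a + b) = der V a + der V b"
  and der_scl: "der V (k \<odot> a) = k \<odot> der V a"
  and der_zero [simp]: "der V 0 = 0"
proof -
  interpret l: Vector_Spaces.linear "scl V" "scl V" "der V" by (rule der_linear)
  show "der V (a + b) = der V a + der V b" "der V (k \<odot> a) = k \<odot> der V a" "der V 0 = 0"
    by (rule l.add l.scale l.zero)+
qed

lemma coeff_pscl [simp]: "coeff (pscl V k p) t = k \<odot> coeff p t"
  by (simp add: pscl_def coeff_map_poly)

lemma lbr_add_right: "lbr V a (b + c) = lbr V a b + lbr V a c"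
  and lbr_scl_right: "lbr V a (k \<odot> b) = pscl V k (lbr V a b)"
  and lbr_zero_right [simp]: "lbr V a 0 = 0"
proof -
  interpret l: Vector_Spaces.linear "scl V" "pscl V" "\<lambda>b. lbr V a b" by (rule lbr_linear_right)
  show "lbr V a (b + c) = lbr V a b + lbr V a c" "lbr V a (k \<odot> b) = pscl V k (lbr V a b)"
    "lbr V a 0 = 0"
    by (rule l.add l.scale l.zero)+
qed

lemma lbr_add_left: "lbr V (a + b) c = lbr V a c + lbr V b c"
  and lbr_scl_left: "lbr V (k \<odot> a) b = pscl V k (lbr V a b)"
  and lbr_zero_left [simp]: "lbr V 0 b = 0"
proof -
  interpret l: Vector_Spaces.linear "scl V" "pscl V" "\<lambda>a. lbr V a b" for b by (rule lbr_linear_left)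
  show "lbr V (a + b) c = lbr V a c + lbr V b c" "lbr V (k \<odot> a) b = pscl V k (lbr V a b)"
    "lbr V 0 b = 0"
    by (rule l.add l.scale l.zero)+
qed

lemma der_pow_zero [simp]: "(der V ^^ n) 0 = 0"
  by (induction n) auto

lemma der_pow_even: "a \<in> parity V p \<Longrightarrow> (der V ^^ n) a \<in> parity V p"
  by (induction n) (auto simp: der_even)

lemma dder_zero_index [simp]: "dder V 0 a = a"
  by (simp add: dder_def)

lemma zprod_zero_left [simp]: "zprod V 0 k b = 0"
  and zprod_zero_right [simp]: "zprod V a k 0 = 0"
  by (auto simp: zprod_def nprod_def dder_def)

lemma zprod_minus_one: "zprod V a (- 1) b = a \<cdot> b"
  by (simp add: zprod_def)

lemma subspace_der_pow:
  assumes "subspace X" "\<And>v. v \<in> X \<Longrightarrow> der V v \<in> X" "v \<in> X"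
  shows "(der V ^^ n) v \<in> X"
  using assms by (induction n) auto

text \<open>By \<open>lbr_der\<close>, each \<open>der V\<close> on the left multiplies the bracket
  by \<open>- \<lambda>\<close>, which shifts and negates its coefficients.\<close>

lemma coeff_lbr_der_pow_left:
  assumes "subspace X" "\<And>t. coeff (lbr V a b) t \<in> X"
  shows "coeff (lbr V ((der V ^^ n) a) b) t \<in> X"
proof (induction n arbitrary: t)
  case 0
  then show ?case using assms by simp
next
  case (Suc n)
  then show ?case
    using assms(1) by (auto simp: lbr_der coeff_pCons subspace_neg subspace_0 split: nat.split)
qed

text \<open>\<open>der_lbr\<close> is solved for the bracket with \<open>der V\<close> on the right:
  one term is \<open>der V\<close> of a coefficient, which stays in the stable subspace
  \<open>X\<close>, the other has \<open>der V\<close> on the left.\<close>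

lemma coeff_lbr_der_pow_right:
  assumes "subspace X" "\<And>v. v \<in> X \<Longrightarrow> der V v \<in> X" "\<And>t. coeff (lbr V a b) t \<in> X"
  shows "coeff (lbr V a ((der V ^^ n) b)) t \<in> X"
proof (induction n arbitrary: t)
  case 0
  then show ?case using assms by simp
next
  case (Suc n)
  let ?b = "(der V ^^ n) b"
  have "coeff (lbr V a (der V ?b)) t =
      der V (coeff (lbr V a ?b) t) - coeff (lbr V (der V a) ?b) t"
    using arg_cong[OF der_lbr[of a ?b], of "\<lambda>p. coeff p t"] by (simp add: coeff_map_poly)
  moreover have "coeff (lbr V (der V a) ?b) t \<in> X"
    using coeff_lbr_der_pow_left[OF assms(1) Suc, of 1] by simp
  ultimately show ?case
    using Suc assms by (simp add: subspace_diff)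
qed

text \<open>This and the next four lemmas supply the predicates for \<open>E_induct\<close>, by
  which statements about spans are reduced to monomials.\<close>

lemma subspace_mul_right: "subspace X \<Longrightarrow> subspace {v. a \<cdot> v \<in> X}"
  by (rule subspaceI) (auto simp: mul_add_right mul_scl_right subspace_add subspace_scale subspace_0)

lemma subspace_mul_left: "subspace X \<Longrightarrow> subspace {v. v \<cdot> b \<in> X}"
  by (rule subspaceI) (auto simp: mul_add_left mul_scl_left subspace_add subspace_scale subspace_0)

lemma subspace_lbr_right: "subspace X \<Longrightarrow> subspace {v. \<forall>t. coeff (lbr V a v) t \<in> X}"
  by (rule subspaceI) (auto simp: lbr_add_right lbr_scl_right subspace_add subspace_scale subspace_0)

lemma subspace_lbr_left: "subspace X \<Longrightarrow> subspace {v. \<forall>t. coeff (lbr V v b) t \<in> X}"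
  by (rule subspaceI) (auto simp: lbr_add_left lbr_scl_left subspace_add subspace_scale subspace_0)

lemma subspace_der: "subspace X \<Longrightarrow> subspace {v. der V v \<in> X}"
  by (rule subspaceI) (auto simp: der_add der_scl subspace_add subspace_scale subspace_0)

lemma mul_sum_left: "(\<Sum>i\<in>A. f i) \<cdot> b = (\<Sum>i\<in>A. f i \<cdot> b)"
  by (induction A rule: infinite_finite_induct) (auto simp: mul_add_left)

lemma mul_sum_right: "a \<cdot> (\<Sum>i\<in>A. f i) = (\<Sum>i\<in>A. a \<cdot> f i)"
  by (induction A rule: infinite_finite_induct) (auto simp: mul_add_right)

lemma coeff_sum_mem:
  assumes "subspace X" "\<And>i. i \<in> I \<Longrightarrow> coeff (p i) t \<in> X"
  shows "coeff (\<Sum>i\<in>I. p i) t \<in> X"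
  using assms by (auto simp: coeff_sum intro: subspace_sum)

text \<open>Meant for the integral term of the Wick formula. Forming the double bracket only moves
  and adds coefficients of the iterated brackets.\<close>

lemma coeff_lbr_lam_mu_mem:
  assumes "subspace X" "\<And>i t. coeff (lbr V (coeff (lbr V a b) i) c) t \<in> X"
  shows "coeff (coeff (lbr_lam_mu V a b c) s) t \<in> X"
proof -
  have "coeff (coeff ((times_lam ^^ i) f) s) t \<in> X" if "\<And>s t. coeff (coeff f s) t \<in> X" for i f s t
    using that
  proof (induction i arbitrary: s t)
    case (Suc i)
    then show ?case
      using assms(1)
      by (auto simp: times_lam_def coeff_map_poly coeff_pCons subspace_0 split: nat.split)
  qed auto
  moreover have "coeff (coeff (map_poly (\<lambda>w. [:w:]) (lbr V (coeff (lbr V a b) i) c)) s) t \<in> X"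
    for i s t
    using assms by (auto simp: coeff_map_poly coeff_pCons subspace_0 split: nat.split)
  ultimately show ?thesis
    unfolding lbr_lam_mu_def psubst_def coeff_sum by (intro subspace_sum[OF assms(1)]) auto
qed

lemma coeff_int_mu_mem:
  assumes "subspace X" "\<And>s t. coeff (coeff f s) t \<in> X"
  shows "coeff (int_mu V f) t \<in> X"
proof -
  have "coeff ((pCons 0 ^^ i) p) t \<in> X" if "\<And>t. coeff p t \<in> X" for i p t
    using that
  proof (induction i arbitrary: t)
    case (Suc i)
    then show ?case using assms(1) by (auto simp: coeff_pCons subspace_0 split: nat.split)
  qed auto
  from this[where p = "pscl V _ _"] show ?thesis
    unfolding int_mu_def using assms by (intro coeff_sum_mem) (simp_all only: coeff_pscl subspace_scale)
qed

lemma coeff_lbr_skew_mem: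
  assumes "subspace X" "\<And>v. v \<in> X \<Longrightarrow> der V v \<in> X" "\<And>t. coeff (lbr V b a) t \<in> X"
  shows "coeff (lbr_skew V b a) t \<in> X"
proof -
  have "coeff (((\<lambda>f. - pCons 0 f - map_poly (der V) f) ^^ i) p) t \<in> X"
    if "\<And>t. coeff p t \<in> X" for i p t
    using that
  proof (induction i arbitrary: t)
    case (Suc i)
    then show ?case
      using assms
      by (auto simp: coeff_pCons coeff_map_poly subspace_0 subspace_neg subspace_diff split: nat.split)
  qed auto
  then show ?thesis
    unfolding lbr_skew_def psubst_def using assms
    by (intro coeff_sum_mem) (auto simp: coeff_pCons subspace_0 split: nat.split)
qed

end

section \<open>The unit, skew-symmetry and commutators\<close>

context assoc_unital_vertex_algebra
begin

lemma der_unit [simp]: "der V \<one> = 0"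
  using der_mul[of \<one> \<one>] by (simp add: unit_left unit_right)

text \<open>Otherwise \<open>T[a\<^sub>\<lambda>\<one>] = - \<lambda>[a\<^sub>\<lambda>\<one>]\<close> would contradict a comparison of degrees.\<close>

lemma lbr_unit_right [simp]: "lbr V a \<one> = 0"
proof (rule ccontr)
  let ?p = "lbr V a \<one>"
  assume ne: "?p \<noteq> 0"
  have "map_poly (der V) ?p = - pCons 0 ?p"
    using der_lbr[of a \<one>] by (simp add: lbr_der)
  then have "coeff (map_poly (der V) ?p) (Suc (degree ?p)) = coeff (- pCons 0 ?p) (Suc (degree ?p))"
    by simp
  then have "coeff ?p (degree ?p) = 0"
    by (simp add: coeff_map_poly coeff_eq_0)
  with ne show False by simp
qed

text \<open>Comparing parities in \<open>\<one> \<cdot> a = a\<close> shows that the odd part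
  \<open>y\<close> of the unit kills every homogeneous \<open>a\<close>; hence
  \<open>y = y \<cdot> \<one> = 0\<close>.\<close>

lemma unit_even: "\<one> \<in> parity V False"
proof -
  obtain x y where xy: "x \<in> parity V False" "y \<in> parity V True" "\<one> = x + y"
    using parity_sum by blast
  have hom: "y \<cdot> a = 0" if "a \<in> parity V p" for a p
  proof -
    have "a - x \<cdot> a = y \<cdot> a"
      using unit_left[of a] unfolding xy(3) mul_add_left by (metis add_diff_cancel_left')
    moreover have "a - x \<cdot> a \<in> parity V p"
      using subspace_diff[OF parity_subspace that] mul_even[OF xy(1) that] by simp
    moreover have "y \<cdot> a \<in> parity V (\<not> p)"
      using mul_even[OF xy(2) that] by simp
    ultimately show ?thesis
      using parity_Int by (cases p) auto
  qed
  have "y = y \<cdot> x + y \<cdot> y"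
    using unit_right[of y] unfolding xy(3) mul_add_right by simp
  then have "y = 0"
    using hom[OF xy(1)] hom[OF xy(2)] by simp
  with xy show ?thesis by simp
qed

text \<open>Substituting \<open>- \<lambda> - T\<close> applies powers of \<open>der V\<close> to
  the coefficients, whence the stability of \<open>X\<close> under \<open>der V\<close>.\<close>

lemma coeff_lbr_swap_mem:
  assumes "a \<in> parity V p" "b \<in> parity V q"
    and "subspace X" "\<And>v. v \<in> X \<Longrightarrow> der V v \<in> X" "\<And>t. coeff (lbr V b a) t \<in> X"
  shows "coeff (lbr V a b) t \<in> X"
  unfolding skew_symmetry[OF assms(1,2)]
  using coeff_lbr_skew_mem[OF assms(3-5)] assms(3) by (auto intro: subspace_neg subspace_scale)

lemma scomm_mem:
  assumes "a \<in> parity V p" "b \<in> parity V q"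
    and "subspace X" "\<And>v. v \<in> X \<Longrightarrow> der V v \<in> X" "\<And>t. coeff (lbr V a b) t \<in> X"
  shows "scomm V p q a b \<in> X"
  unfolding commutator[OF assms(1,2)] dder_def nprod_def
  using assms(3-5) by (intro subspace_sum subspace_scale subspace_der_pow) auto

text \<open>\<open>c\<close> is moved to the front, then past \<open>a\<close> by
  \<open>comm_mul\<close>, then past \<open>b\<close>; each move costs a supercommutator. The three
  signs before \<open>a \<cdot> (b \<cdot> c)\<close> multiply to 1, but they are kept, since later
  only membership in a subspace matters.\<close>

lemma mul_assoc_scomm:
  assumes "a \<in> parity V p" "b \<in> parity V q" "c \<in> parity V r"
  shows "(a \<cdot> b) \<cdot> c =
    scomm V (p \<noteq> q) r (a \<cdot> b) c
    + zeta (p \<noteq> q) r \<odot> (scomm V r p c a \<cdot> b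
      + zeta r p \<odot> (a \<cdot> scomm V r q c b + zeta r q \<odot> (a \<cdot> (b \<cdot> c))))"
proof -
  have "c \<cdot> b = scomm V r q c b + zeta r q \<odot> (b \<cdot> c)"
    by (simp add: scomm_def)
  then have "a \<cdot> (c \<cdot> b) = a \<cdot> scomm V r q c b + zeta r q \<odot> (a \<cdot> (b \<cdot> c))"
    by (simp add: mul_add_right mul_scl_right)
  moreover have "c \<cdot> (a \<cdot> b) = scomm V r p c a \<cdot> b + zeta r p \<odot> (a \<cdot> (c \<cdot> b))"
    using comm_mul[OF assms(3,1)] by simp
  ultimately show ?thesis
    by (simp add: scomm_def)
qed

lemma der_monomial_Nil [simp]: "der_monomial V [] = \<one>"
  and der_monomial_Cons [simp]:
    "der_monomial V (x # xs) = (der V ^^ snd x) (fst x) \<cdot> der_monomial V xs"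
  by (auto simp: der_monomial_def split: prod.split)

end

section \<open>Calculus in an invariant filtration\<close>

text \<open>Filtrations are reindexed by integers: \<open>F n\<close> is the piece of degree \<open>\<rho> n\<close>.\<close>

locale invariant_filtration = assoc_unital_vertex_algebra V
  for V :: "('k::field_char_0, 'v::ab_group_add) valg" (structure) +
  fixes F :: "int \<Rightarrow> 'v set"
  assumes subspace_F: "subspace (F n)"
    and F_Suc: "F n \<subseteq> F (n + 1)"
    and unit_F: "\<one> \<in> F 0"
    and zprod_F: "a \<in> F n \<Longrightarrow> b \<in> F m \<Longrightarrow> zprod V a k b \<in> F (n + m)"
begin

lemma F_mono: "n \<le> m \<Longrightarrow> F n \<subseteq> F m"
  by (induction m rule: int_ge_induct) (use F_Suc in blast)+

lemma mul_F: "a \<in> F n \<Longrightarrow> b \<in> F m \<Longrightarrow> a \<cdot> b \<in> F (n + m)"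
  using zprod_F[of a n b m "- 1"] by (simp add: zprod_minus_one)

lemma coeff_lbr_F:
  assumes "a \<in> F n" "b \<in> F m"
  shows "coeff (lbr V a b) t \<in> F (n + m)"
proof -
  have "fact t \<odot> coeff (lbr V a b) t \<in> F (n + m)"
    using zprod_F[OF assms, of "int t"] by (simp add: zprod_def nprod_def)
  then have "inverse (fact t) \<odot> (fact t \<odot> coeff (lbr V a b) t) \<in> F (n + m)"
    by (rule subspace_scale[OF subspace_F])
  then show ?thesis by simp
qed

text \<open>The product of \<open>a\<close> with \<open>\<one>\<close> at index \<open>- 2\<close>
  is \<open>der V a\<close>, and products with \<open>\<one> \<in> F 0\<close> do not raise the
  degree.\<close>

lemma der_F: "a \<in> F n \<Longrightarrow> der V a \<in> F n"
  using zprod_F[of a n \<one> 0 "- 2"] unit_F by (simp add: zprod_def dder_def unit_right)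

lemma der_pow_F: "a \<in> F n \<Longrightarrow> (der V ^^ i) a \<in> F n"
  by (rule subspace_der_pow[OF subspace_F der_F])

text \<open>The integral term brackets the coefficients of \<open>lbr V a b\<close> with
  \<open>c\<close>, so \<open>coeff_lbr_F\<close> controls it. Here \<open>n\<close> bounds only
  brackets with \<open>a\<close>; in the applications it is one less than the degree of
  \<open>a\<close>.\<close>

lemma wick_F:
  assumes "a \<in> parity V p" "b \<in> parity V q" "b \<in> F m" "c \<in> F k"
    and "\<And>t. coeff (lbr V a b) t \<in> F (n + m)" "\<And>t. coeff (lbr V a c) t \<in> F (n + k)"
  shows "coeff (lbr V a (b \<cdot> c)) t \<in> F (n + (m + k))"
proof -
  note S = subspace_F[of "n + (m + k)"]
  have "coeff (map_poly (\<lambda>v. v \<cdot> c) (lbr V a b)) t \<in> F (n + (m + k))"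
    using mul_F[OF assms(5,4)] by (simp add: coeff_map_poly add.assoc)
  moreover have "coeff (map_poly (\<lambda>v. b \<cdot> v) (lbr V a c)) t \<in> F (n + (m + k))"
    using mul_F[OF assms(3,6)] by (simp add: coeff_map_poly ac_simps)
  moreover have "coeff (int_mu V (lbr_lam_mu V a b c)) t \<in> F (n + (m + k))"
    using coeff_lbr_F[OF assms(5,4)]
    by (intro coeff_int_mu_mem coeff_lbr_lam_mu_mem S) (simp add: add.assoc)
  ultimately show ?thesis
    unfolding wick[OF assms(1,2)] using S by (auto intro!: subspace_add subspace_scale)
qed

end


section \<open>Monomials in the generators\<close>

locale generated_invariant_filtration = invariant_filtration V F
  for V :: "('k::field_char_0, 'v::ab_group_add) valg" (structure) and F +
  fixes S :: "'v set" and H :: "'v \<Rightarrow> int"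
  assumes S_homogeneous: "S \<subseteq> parity V False \<union> parity V True"
    and H_nonneg: "a \<in> S \<Longrightarrow> 0 \<le> H a"
    and S_F: "a \<in> S \<Longrightarrow> a \<in> F (H a)"
    and F_least: "invariant_filtration V F' \<Longrightarrow> (\<And>a. a \<in> S \<Longrightarrow> a \<in> F' (H a)) \<Longrightarrow> F n \<subseteq> F' n"
    and lbr_S: "a \<in> S \<Longrightarrow> b \<in> S \<Longrightarrow> coeff (lbr V a b) t \<in> F (H a + H b - 1)"
begin

text \<open>The exponents of \<open>der V\<close> do not count, in accordance with
  \<open>der_F\<close>.\<close>

definition weight :: "('v \<times> nat) list \<Rightarrow> int" where
  "weight xs = (\<Sum>x\<leftarrow>xs. H (fst x))"

lemma weight_Nil [simp]: "weight [] = 0"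
  and weight_Cons [simp]: "weight (x # xs) = H (fst x) + weight xs"
  by (auto simp: weight_def)

definition letters :: "('v \<times> nat) list \<Rightarrow> bool" where
  "letters xs \<longleftrightarrow> set xs \<subseteq> S \<times> UNIV"

lemma letters_Nil [simp]: "letters []"
  and letters_Cons [simp]: "letters (x # xs) \<longleftrightarrow> fst x \<in> S \<and> letters xs"
  by (auto simp: letters_def mem_Times_iff)

definition E :: "int \<Rightarrow> 'v set" where
  "E n = span {der_monomial V xs | xs. letters xs \<and> weight xs \<le> n}"

lemma subspace_E: "subspace (E n)"
  by (simp add: E_def)

lemma monomial_E: "letters xs \<Longrightarrow> weight xs \<le> n \<Longrightarrow> der_monomial V xs \<in> E n"
  by (auto simp: E_def intro: span_base)

lemma E_mono: "n \<le> m \<Longrightarrow> E n \<subseteq> E m"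
  unfolding E_def by (rule span_mono) auto

lemma E_induct [consumes 1, case_names subspace monomial]:
  assumes "v \<in> E n" "subspace {v. P v}"
    and "\<And>xs. letters xs \<Longrightarrow> weight xs \<le> n \<Longrightarrow> P (der_monomial V xs)"
  shows "P v"
proof -
  have "E n \<subseteq> {v. P v}"
    unfolding E_def using assms(2,3) by (intro span_minimal) auto
  with assms(1) show ?thesis by blast
qed

lemma letter_mul_E:
  assumes "a \<in> S" "v \<in> E n"
  shows "(der V ^^ i) a \<cdot> v \<in> E (H a + n)"
  using assms(2)
proof (induction rule: E_induct)
  case (monomial xs)
  then show ?case using monomial_E[of "(a, i) # xs"] assms(1) by simp
qed (rule subspace_mul_right[OF subspace_E])

lemma der_monomial_E: "letters xs \<Longrightarrow> weight xs \<le> n \<Longrightarrow> der V (der_monomial V xs) \<in> E n"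
proof (induction xs arbitrary: n)
  case Nil
  then show ?case by (simp add: subspace_0[OF subspace_E])
next
  case (Cons x xs)
  let ?a = "(der V ^^ snd x) (fst x)"
  have "der V ?a \<cdot> der_monomial V xs \<in> E n"
    using monomial_E[of "(fst x, Suc (snd x)) # xs"] Cons by simp
  moreover have "?a \<cdot> der V (der_monomial V xs) \<in> E n"
    using letter_mul_E[of "fst x" _ "n - H (fst x)" "snd x"] Cons by simp
  ultimately show ?case
    by (simp add: der_mul subspace_add[OF subspace_E])
qed

lemma der_E: "v \<in> E n \<Longrightarrow> der V v \<in> E n"
  by (induction rule: E_induct)
    (auto simp: der_monomial_E intro: subspace_der[OF subspace_E])

lemma dder_E: "v \<in> E n \<Longrightarrow> dder V i v \<in> E n"
  unfolding dder_def
  by (intro subspace_scale[OF subspace_E] subspace_der_pow[OF subspace_E der_E])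

lemma letter_F: "a \<in> S \<Longrightarrow> (der V ^^ i) a \<in> F (H a)"
  by (intro der_pow_F S_F)

lemma letter_parity: "a \<in> S \<Longrightarrow> \<exists>p. (der V ^^ i) a \<in> parity V p"
  using S_homogeneous der_pow_even by blast

lemma monomial_F: "letters xs \<Longrightarrow> der_monomial V xs \<in> F (weight xs)"
  by (induction xs) (auto simp: unit_F intro: mul_F letter_F)

lemma monomial_parity: "letters xs \<Longrightarrow> \<exists>p. der_monomial V xs \<in> parity V p"
proof (induction xs)
  case Nil
  then show ?case using unit_even by auto
next
  case (Cons x xs)
  then show ?case using letter_parity[of "fst x" "snd x"] mul_even by fastforce
qed

section \<open>Brackets and commutators of monomials\<close>

lemma lbr_letters:
  "a \<in> S \<Longrightarrow> b \<in> S \<Longrightarrow>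
    coeff (lbr V ((der V ^^ i) a) ((der V ^^ j) b)) t \<in> F (H a + H b - 1)"
  by (intro coeff_lbr_der_pow_left coeff_lbr_der_pow_right subspace_F der_F lbr_S)

text \<open>The Wick formula strips off one letter at a time. The induction starts at the unit,
  whose bracket with \<open>a\<close> vanishes, so a drop in degree built into \<open>n\<close>
  holds for the empty list too.\<close>

lemma lbr_monomial_right:
  assumes "a \<in> parity V p" "letters ys"
    and "\<And>b j t. b \<in> S \<Longrightarrow> coeff (lbr V a ((der V ^^ j) b)) t \<in> F (n + H b)"
  shows "coeff (lbr V a (der_monomial V ys)) t \<in> F (n + weight ys)"
  using assms(2)
proof (induction ys arbitrary: t)
  case Nil
  then show ?case by (simp add: subspace_0[OF subspace_F])
next
  case (Cons y ys)
  then obtain q where "(der V ^^ snd y) (fst y) \<in> parity V q"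
    using letter_parity by force
  from wick_F[OF assms(1) this letter_F monomial_F assms(3)] Cons show ?case
    by simp
qed

text \<open>Skew-symmetry lets the left Wick formula treat the monomial on the left as well.\<close>

lemma lbr_monomials:
  assumes "letters xs" "letters ys"
  shows "coeff (lbr V (der_monomial V xs) (der_monomial V ys)) t \<in> F (weight xs + weight ys - 1)"
proof -
  obtain p where p: "der_monomial V xs \<in> parity V p"
    using monomial_parity[OF assms(1)] by blast
  \<comment> \<open>\<open>lbr_monomial_right\<close> is used twice: first with the letter on the
    left and \<open>n = H b - 1\<close>, then with the monomial on the left and
    \<open>n = weight xs - 1\<close>.\<close>
  have "coeff (lbr V (der_monomial V xs) ((der V ^^ j) b)) t \<in> F (weight xs - 1 + H b)"
    if b: "b \<in> S" for b j t
  proof -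
    obtain q where q: "(der V ^^ j) b \<in> parity V q"
      using letter_parity[OF b] by blast
    have "coeff (lbr V ((der V ^^ j) b) (der_monomial V xs)) t \<in> F (H b - 1 + weight xs)" for t
      using lbr_letters[OF b] by (intro lbr_monomial_right[OF q assms(1)]) (simp add: algebra_simps)
    then show ?thesis
      by (intro coeff_lbr_swap_mem[OF p q] subspace_F der_F) (simp_all add: algebra_simps)
  qed
  from lbr_monomial_right[OF p assms(2) this] show ?thesis
    by (simp add: algebra_simps)
qed

lemma scomm_monomials:
  assumes "letters xs" "letters ys" "der_monomial V xs \<in> parity V p" "der_monomial V ys \<in> parity V q"
  shows "scomm V p q (der_monomial V xs) (der_monomial V ys) \<in> F (weight xs + weight ys - 1)"
  by (intro scomm_mem[OF assms(3,4)] subspace_F der_F lbr_monomials assms)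

text \<open>The bound is in \<open>F\<close>, not in \<open>E\<close>; because the degree drops by
  one, an inclusion \<open>F m \<subseteq> E m\<close> for smaller \<open>m\<close> brings the
  bracket back into \<open>E\<close>.\<close>

lemma lbr_E:
  assumes "a \<in> E n" "b \<in> E m"
  shows "coeff (lbr V a b) t \<in> F (n + m - 1)"
proof -
  have "\<forall>t. coeff (lbr V a b) t \<in> F (n + m - 1)"
    using assms(1)
  proof (induction rule: E_induct)
    case (monomial xs)
    from assms(2) have "\<forall>t. coeff (lbr V (der_monomial V xs) b) t \<in> F (n + m - 1)"
    proof (induction rule: E_induct)
      case (monomial ys)
      then show ?case
        using lbr_monomials[of xs ys] \<open>letters xs\<close> \<open>weight xs \<le> n\<close>
          F_mono[of "weight xs + weight ys - 1" "n + m - 1"] by auto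
    qed (rule subspace_lbr_right[OF subspace_F])
    then show ?case by blast
  qed (rule subspace_lbr_left[OF subspace_F])
  then show ?thesis ..
qed

section \<open>Products of the spans \<open>E n\<close>\<close>

lemma nprod_E: "a \<in> E n \<Longrightarrow> b \<in> E m \<Longrightarrow> nprod V a t b \<in> F (n + m - 1)"
  unfolding nprod_def by (intro subspace_scale[OF subspace_F] lbr_E)

text \<open>Induction on the left factor, with \<open>mul_assoc_scomm\<close> moving the brackets to
  the right; \<open>n\<close> varies because the induction hypothesis is used at
  \<open>n - H (fst x)\<close>.\<close>

lemma monomial_mul_E:
  assumes "\<And>m. m < n \<Longrightarrow> F m \<subseteq> E m"
    and "letters xs" "letters ys" "weight xs + weight ys \<le> n"
  shows "der_monomial V xs \<cdot> der_monomial V ys \<in> E n"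
  using assms
proof (induction xs arbitrary: ys n)
  case Nil
  then show ?case by (simp add: unit_left monomial_E)
next
  case (Cons x xs)
  let ?a = "(der V ^^ snd x) (fst x)" and ?b = "der_monomial V xs" and ?c = "der_monomial V ys"
  have x: "fst x \<in> S" "letters [x]" "letters xs" "letters ys" "letters (x # xs)"
    using Cons.prems by auto
  \<comment> \<open>A letter is read as a one-letter monomial, so that
    \<open>scomm_monomials\<close> covers it.\<close>
  have a: "der_monomial V [x] = ?a"
    by (simp add: unit_right)
  obtain p q r where par: "?a \<in> parity V p" "?b \<in> parity V q" "?c \<in> parity V r"
    using letter_parity x monomial_parity by meson
  have ab: "der_monomial V (x # xs) \<in> parity V (p \<noteq> q)"
    using mul_even[OF par(1,2)] by simp
  \<comment> \<open>The drop in degree puts each commutator term into \<open>F (n - 1)\<close>, to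
    which the assumption applies.\<close>
  have low: "v \<in> E n" if "v \<in> F (weight (x # xs) + weight ys - 1)" for v
    using that Cons.prems(1)[of "n - 1"] F_mono[of "weight (x # xs) + weight ys - 1" "n - 1"]
      E_mono[of "n - 1" n] Cons.prems(4) by auto
  have 1: "scomm V (p \<noteq> q) r (?a \<cdot> ?b) ?c \<in> E n"
    using scomm_monomials[OF x(5,4) ab par(3)] by (intro low) simp
  have 2: "scomm V r p ?c ?a \<cdot> ?b \<in> E n"
    using mul_F[OF scomm_monomials[OF x(4,2) par(3)] monomial_F[OF x(3)]] par(1)
    by (intro low) (simp add: unit_right algebra_simps)
  have 3: "?a \<cdot> scomm V r q ?c ?b \<in> E n"
    using mul_F[OF letter_F[OF x(1)] scomm_monomials[OF x(4,3) par(3,2)]]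
    by (intro low) (simp add: algebra_simps)
  \<comment> \<open>As \<open>H\<close> is nonnegative, \<open>n - H (fst x) \<le> n\<close>, so the
    assumption on \<open>F\<close> below \<open>n\<close> is inherited.\<close>
  have "?b \<cdot> ?c \<in> E (n - H (fst x))"
    using Cons.prems x H_nonneg[OF x(1)] by (intro Cons.IH) auto
  then have 4: "?a \<cdot> (?b \<cdot> ?c) \<in> E n"
    using letter_mul_E[OF x(1), of _ "n - H (fst x)"] by simp
  show ?case
    using mul_assoc_scomm[OF par] 1 2 3 4
    by (simp add: subspace_add subspace_scale subspace_E)
qed

lemma mul_E:
  assumes "\<And>m. m < n + k \<Longrightarrow> F m \<subseteq> E m" "a \<in> E n" "b \<in> E k"
  shows "a \<cdot> b \<in> E (n + k)"
  using assms(2)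
proof (induction rule: E_induct)
  case (monomial xs)
  from assms(3) show ?case
  proof (induction rule: E_induct)
    case (monomial ys)
    then show ?case
      using \<open>letters xs\<close> \<open>weight xs \<le> n\<close> by (intro monomial_mul_E[OF assms(1)]) auto
  qed (rule subspace_mul_right[OF subspace_E])
qed (rule subspace_mul_left[OF subspace_E])

lemma zprod_E:
  assumes "\<And>m. m < n + k \<Longrightarrow> F m \<subseteq> E m" "a \<in> E n" "b \<in> E k"
  shows "zprod V a t b \<in> E (n + k)"
proof (cases "0 \<le> t")
  case True
  then show ?thesis
    using nprod_E[OF assms(2,3)] assms(1)[of "n + k - 1"] E_mono[of "n + k - 1" "n + k"]
    by (auto simp: zprod_def)
next
  case False
  then show ?thesis
    using mul_E[OF assms(1) dder_E[OF assms(2)] assms(3)] by (simp add: zprod_def)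
qed

section \<open>Consequences of minimality\<close>

lemma F_negative:
  assumes "n < 0"
  shows "F n = {0}"
proof -
  \<comment> \<open>A test filtration: products with a factor of negative degree are zero, and it
    contains the generators because their degrees are nonnegative.\<close>
  define F' where "F' n = (if n < 0 then {0} else UNIV :: 'v set)" for n :: int
  have zprod: "zprod V a t b \<in> F' (m + k)" if "a \<in> F' m" "b \<in> F' k" for a b m k t
  proof (cases "m < 0 \<or> k < 0")
    case True
    then have "a = 0 \<or> b = 0"
      using that unfolding F'_def by (auto split: if_splits)
    then have "zprod V a t b = 0" by auto
    then show ?thesis by (simp add: F'_def)
  qed (simp add: F'_def)
  have one: "\<one> \<in> F' 0" by (simp add: F'_def)
  have mono: "F' m \<subseteq> F' (m + 1)" for m by (simp add: F'_def)
  have sub: "subspace (F' m)" for m by (simp add: F'_def)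
  have "invariant_filtration V F'"
    by unfold_locales (rule sub mono one zprod; assumption)+
  moreover have "a \<in> F' (H a)" if "a \<in> S" for a
    using H_nonneg[OF that] by (simp add: F'_def)
  ultimately have "F n \<subseteq> F' n"
    by (rule F_least)
  then show ?thesis
    using assms subspace_0[OF subspace_F, of n] by (auto simp: F'_def)
qed

lemma F_subset_E: "F (int n) \<subseteq> E (int n)"
proof (induction n rule: less_induct)
  case (less n)
  have below: "F m \<subseteq> E m" if "m < int n" for m
  proof (cases "m < 0")
    case True
    then show ?thesis by (simp add: F_negative subspace_0[OF subspace_E])
  next
    case False
    then show ?thesis using less[of "nat m"] that by simp
  qed
  \<comment> \<open>Only degrees up to \<open>n\<close> are cut down, so a product of degree above
    \<open>n\<close> needs nothing beyond \<open>zprod_F\<close>.\<close>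
  define F' where "F' m = (if m \<le> int n then F m \<inter> E m else F m)" for m
  have zprod: "zprod V a t b \<in> F' (m + k)" if ab: "a \<in> F' m" "b \<in> F' k" for a b m k t
  proof -
    have mem: "a \<in> F m" "b \<in> F k"
      using ab by (auto simp: F'_def split: if_splits)
    show ?thesis
    proof (cases "m + k \<le> int n")
      case le: True
      show ?thesis
      proof (cases "m < 0 \<or> k < 0")
        case True
        then have "zprod V a t b = 0"
          using mem F_negative by auto
        then show ?thesis
          by (auto simp: F'_def subspace_0 subspace_F subspace_E)
      next
        \<comment> \<open>Both degrees are nonnegative with sum at most \<open>n\<close>, so each is
          at most \<open>n\<close> and both factors lie in \<open>E\<close>. For the product,
          \<open>zprod_E\<close> uses \<open>below\<close> only strictly under the total
          degree.\<close>
        case False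
        then have "a \<in> E m" "b \<in> E k"
          using ab le by (auto simp: F'_def split: if_splits)
        then have "zprod V a t b \<in> E (m + k)"
          using below le by (intro zprod_E) auto
        then show ?thesis
          using zprod_F[OF mem] by (simp add: F'_def)
      qed
    qed (use zprod_F[OF mem] in \<open>simp add: F'_def\<close>)
  qed
  have one: "\<one> \<in> F' 0"
    using unit_F monomial_E[of "[]" 0] by (simp add: F'_def)
  have mono: "F' m \<subseteq> F' (m + 1)" for m
    using F_Suc[of m] E_mono[of m "m + 1"] by (auto simp: F'_def)
  have sub: "subspace (F' m)" for m
    by (simp add: F'_def subspace_F subspace_E subspace_inter)
  have "invariant_filtration V F'"
    by unfold_locales (rule sub mono one zprod; assumption)+
  moreover have "a \<in> F' (H a)" if "a \<in> S" for a
    using S_F[OF that] monomial_E[of "[(a, 0)]" "H a"] that by (simp add: F'_def unit_right)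
  ultimately have "F (int n) \<subseteq> F' (int n)"
    by (rule F_least)
  then show ?case by (simp add: F'_def)
qed

section \<open>Sorting monomials\<close>

text \<open>\<open>comm_mul\<close> exchanges the two leading letters of a right-nested product at
  the cost of one commutator term, with no associator. The scalar \<open>c\<close> collects the
  signs; the error stays in \<open>F\<close>, where an induction on the degree absorbs it
  later.\<close>

lemma insert_sorted:
  assumes r: "linear_order_on (S \<times> UNIV) r"
    and "letters (x # ys)" "sorted_wrt (\<lambda>x y. (y, x) \<in> r) ys"
  shows "\<exists>zs c. set zs = set (x # ys) \<and> weight zs = weight (x # ys) \<and>
    sorted_wrt (\<lambda>x y. (y, x) \<in> r) zs \<and>
    der_monomial V (x # ys) - c \<odot> der_monomial V zs \<in> F (weight (x # ys) - 1)"
  using assms(2,3)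
proof (induction ys)
  case Nil
  then show ?case
    by (intro exI[of _ "[x]"] exI[of _ 1]) (simp add: subspace_0[OF subspace_F])
next
  case (Cons y ys)
  have xy: "x \<in> S \<times> UNIV" "y \<in> S \<times> UNIV" "letters [x]" "letters [y]" "letters ys"
    using Cons.prems by (auto simp: mem_Times_iff)
  have tr: "trans r" and refl: "refl_on (S \<times> UNIV) r" and tot: "total_on (S \<times> UNIV) r"
    using r by (auto simp: linear_order_on_def partial_order_on_def preorder_on_def)
  show ?case
  proof (cases "(y, x) \<in> r")
    case True
    then have "sorted_wrt (\<lambda>x y. (y, x) \<in> r) (x # y # ys)"
      using Cons.prems(2) transD[OF tr _ True] by simp
    then show ?thesis
      by (intro exI[of _ "x # y # ys"] exI[of _ 1]) (simp add: subspace_0[OF subspace_F])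
  next
    case False
    then have le: "(x, y) \<in> r"
      using tot refl xy unfolding total_on_def refl_on_def by metis
    obtain zs c where zs: "set zs = set (x # ys)" "weight zs = weight (x # ys)"
        "sorted_wrt (\<lambda>x y. (y, x) \<in> r) zs"
        "der_monomial V (x # ys) - c \<odot> der_monomial V zs \<in> F (weight (x # ys) - 1)"
      using Cons by auto
    let ?a = "(der V ^^ snd x) (fst x)" and ?b = "(der V ^^ snd y) (fst y)"
      and ?w = "der_monomial V ys"
    obtain p q where par: "?a \<in> parity V p" "?b \<in> parity V q"
      using letter_parity xy by (meson letters_Cons)
    have swap: "?a \<cdot> (?b \<cdot> ?w) = scomm V p q ?a ?b \<cdot> ?w + zeta p q \<odot> (?b \<cdot> (?a \<cdot> ?w))"
      using comm_mul[OF par] by simp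
    have 1: "scomm V p q ?a ?b \<cdot> ?w \<in> F (weight (x # y # ys) - 1)"
      using mul_F[OF scomm_monomials[OF xy(3,4)] monomial_F[OF xy(5)], of p q] par
      by (simp add: unit_right algebra_simps)
    have "?b \<cdot> (?a \<cdot> ?w - c \<odot> der_monomial V zs) \<in> F (weight (x # y # ys) - 1)"
      using mul_F[OF letter_F zs(4), of "fst y" "snd y"] xy(4) by (simp add: algebra_simps)
    then have 2: "?b \<cdot> (?a \<cdot> ?w) - c \<odot> der_monomial V (y # zs) \<in> F (weight (x # y # ys) - 1)"
      using mul_add_right[of ?b "?a \<cdot> ?w - c \<odot> der_monomial V zs" "c \<odot> der_monomial V zs"]
      by (simp add: mul_scl_right)
    have "der_monomial V (x # y # ys) - (zeta p q * c) \<odot> der_monomial V (y # zs) =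
        scomm V p q ?a ?b \<cdot> ?w
        + zeta p q \<odot> (?b \<cdot> (?a \<cdot> ?w) - c \<odot> der_monomial V (y # zs))"
      by (simp add: swap scale_right_diff_distrib)
    also have "\<dots> \<in> F (weight (x # y # ys) - 1)"
      using 1 2 by (intro subspace_add subspace_scale subspace_F)
    finally have "der_monomial V (x # y # ys) - (zeta p q * c) \<odot> der_monomial V (y # zs)
        \<in> F (weight (x # y # ys) - 1)" .
    \<comment> \<open>Every entry of \<open>zs\<close> is \<open>x\<close> or an entry of
      \<open>ys\<close>, hence at most \<open>y\<close>; the equality of sets is carried along for
      this.\<close>
    moreover have "sorted_wrt (\<lambda>x y. (y, x) \<in> r) (y # zs)"
      using zs(1,3) le Cons.prems(2) by auto
    ultimately show ?thesis
      using zs(1,2) by (intro exI[of _ "y # zs"] exI[of _ "zeta p q * c"]) auto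
  qed
qed

text \<open>Insertion sort. Multiplying by the first letter raises the degree of the error by the
  weight of that letter, so it stays one below the total.\<close>

lemma sort_monomial:
  assumes r: "linear_order_on (S \<times> UNIV) r" and "letters xs"
  shows "\<exists>zs c. set zs = set xs \<and> weight zs = weight xs \<and>
    sorted_wrt (\<lambda>x y. (y, x) \<in> r) zs \<and>
    der_monomial V xs - c \<odot> der_monomial V zs \<in> F (weight xs - 1)"
  using assms(2)
proof (induction xs)
  case Nil
  then show ?case
    by (intro exI[of _ "[]"] exI[of _ 1]) (simp add: subspace_0[OF subspace_F])
next
  case (Cons x xs)
  then obtain ys c where ys: "set ys = set xs" "weight ys = weight xs"
      "sorted_wrt (\<lambda>x y. (y, x) \<in> r) ys"
      "der_monomial V xs - c \<odot> der_monomial V ys \<in> F (weight xs - 1)"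
    by auto
  have "letters (x # ys)"
    using Cons.prems ys(1) by (simp add: letters_def)
  from insert_sorted[OF r this ys(3)] obtain zs d where zs: "set zs = set (x # ys)"
      "weight zs = weight (x # ys)" "sorted_wrt (\<lambda>x y. (y, x) \<in> r) zs"
      "der_monomial V (x # ys) - d \<odot> der_monomial V zs \<in> F (weight (x # ys) - 1)"
    by blast
  let ?a = "(der V ^^ snd x) (fst x)"
  have "?a \<cdot> (der_monomial V xs - c \<odot> der_monomial V ys) \<in> F (weight (x # xs) - 1)"
    using mul_F[OF letter_F ys(4), of "fst x" "snd x"] Cons.prems by (simp add: algebra_simps)
  moreover have "?a \<cdot> (der_monomial V xs - c \<odot> der_monomial V ys) =
      der_monomial V (x # xs) - c \<odot> der_monomial V (x # ys)"
    using mul_add_right[of ?a "der_monomial V xs - c \<odot> der_monomial V ys" "c \<odot> der_monomial V ys"]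
    by (simp add: mul_scl_right)
  moreover have "c \<odot> (der_monomial V (x # ys) - d \<odot> der_monomial V zs) \<in> F (weight (x # xs) - 1)"
    using zs(4) ys(2) by (auto intro!: subspace_scale[OF subspace_F])
  \<comment> \<open>The two errors telescope through the monomial of \<open>x # ys\<close>, which
    yields the scalar \<open>c * d\<close>.\<close>
  ultimately have "der_monomial V (x # xs) - (c * d) \<odot> der_monomial V zs \<in> F (weight (x # xs) - 1)"
    using subspace_add[OF subspace_F, of "der_monomial V (x # xs) - c \<odot> der_monomial V (x # ys)"]
    by (fastforce simp: scale_right_diff_distrib)
  then show ?case
    using zs ys by (intro exI[of _ zs] exI[of _ "c * d"]) auto
qed

text \<open>By \<open>F_subset_E\<close> only monomials have to be treated; sorting one leaves an
  error of strictly smaller degree, covered by the induction or zero.\<close>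

lemma F_subset_sorted_span:
  assumes r: "linear_order_on (S \<times> UNIV) r"
  shows "F (int n) \<subseteq> span {der_monomial V xs | xs.
    set xs \<subseteq> S \<times> UNIV \<and> sorted_wrt (\<lambda>x y. (y, x) \<in> r) xs}" (is "_ \<subseteq> ?P")
proof (induction n rule: less_induct)
  case (less n)
  have low: "F m \<subseteq> ?P" if "m < int n" for m
  proof (cases "m < 0")
    case True
    then show ?thesis by (simp add: F_negative span_zero)
  next
    case False
    then show ?thesis using less[of "nat m"] that by simp
  qed
  have "der_monomial V xs \<in> ?P" if xs: "letters xs" "weight xs \<le> int n" for xs
  proof -
    obtain zs c where zs: "set zs = set xs" "sorted_wrt (\<lambda>x y. (y, x) \<in> r) zs"
        "der_monomial V xs - c \<odot> der_monomial V zs \<in> F (weight xs - 1)"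
      using sort_monomial[OF r xs(1)] by blast
    have "der_monomial V zs \<in> ?P"
      using zs xs(1) by (intro span_base) (auto simp: letters_def)
    moreover have "der_monomial V xs - c \<odot> der_monomial V zs \<in> ?P"
      using zs(3) low[of "weight xs - 1"] xs(2) by auto
    ultimately have "(der_monomial V xs - c \<odot> der_monomial V zs) + c \<odot> der_monomial V zs \<in> ?P"
      by (intro span_add span_scale)
    then show ?thesis by simp
  qed
  then have "E (int n) \<subseteq> ?P"
    unfolding E_def by (intro span_minimal) auto
  with F_subset_E show ?case by blast
qed

text \<open>The filtration exhausts the algebra: the union of its pieces contains \<open>S\<close>
  and \<open>\<one>\<close> and is closed under all operations.\<close>

lemma PBW:
  assumes "generates_vertex_algebra V S"
  shows "generates_PBW V S"
proof -
  define W where "W = (\<Union>n::nat. F (int n))"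
  have WI: "a \<in> W" if "a \<in> F n" "0 \<le> n" for a n
    using that unfolding W_def by (auto elim!: nonneg_int_cases)
  have WE: "\<exists>n\<ge>0. a \<in> F n \<and> b \<in> F n" if ab: "a \<in> W" "b \<in> W" for a b
  proof -
    obtain i j where "a \<in> F (int i)" "b \<in> F (int j)"
      using ab unfolding W_def by blast
    then show ?thesis
      using F_mono[of "int i" "int (max i j)"] F_mono[of "int j" "int (max i j)"]
      by (intro exI[of _ "int (max i j)"]) auto
  qed
  have sub: "subspace W"
  proof (rule subspaceI)
    show "0 \<in> W" by (rule WI[of _ 0]) (simp_all add: subspace_0[OF subspace_F])
    show "a + b \<in> W" if "a \<in> W" "b \<in> W" for a b
      using WE[OF that] by (auto intro: WI subspace_add[OF subspace_F])
    show "c \<odot> a \<in> W" if "a \<in> W" for c a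
      using WE[OF that that] by (auto intro: WI subspace_scale[OF subspace_F])
  qed
  have zprod: "zprod V a t b \<in> W" if "a \<in> W" "b \<in> W" for a b t
  proof -
    from WE[OF that] obtain n where "0 \<le> n" "a \<in> F n" "b \<in> F n"
      by blast
    then show ?thesis
      by (intro WI[OF zprod_F[of a n b n]]) auto
  qed
  have mul: "a \<cdot> b \<in> W" if "a \<in> W" "b \<in> W" for a b
    using zprod[OF that, of "- 1"] by (simp add: zprod_minus_one)
  have nprod: "nprod V a t b \<in> W" if "a \<in> W" "b \<in> W" for a b t
    using zprod[OF that, of "int t"] by (simp add: zprod_def)
  have der: "der V a \<in> W" if "a \<in> W" for a
    using WE[OF that that] by (auto intro: WI der_F)
  have "S \<subseteq> W" "\<one> \<in> W"
    using WI S_F H_nonneg unit_F by auto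
  then have "W = UNIV"
    using assms sub mul nprod der unfolding generates_vertex_algebra_def by simp
  show ?thesis
    unfolding generates_PBW_def
  proof (intro allI impI)
    fix r assume r: "linear_order_on (S \<times> (UNIV :: nat set)) r"
    show "span {der_monomial V xs | xs.
        set xs \<subseteq> S \<times> UNIV \<and> sorted_wrt (\<lambda>x y. (y, x) \<in> r) xs} = UNIV"
      using F_subset_sorted_span[OF r] \<open>W = UNIV\<close> unfolding W_def by blast
  qed
qed

end

section \<open>Passing between integer and rational degrees\<close>

context assoc_unital_vertex_algebra
begin

lemma invariant_filtration_of_rat:
  assumes "inv_filtration V \<rho> F"
  shows "invariant_filtration V (\<lambda>n. F (\<rho> * of_int n))"
proof
  have Z: "\<rho> * of_int n \<in> rhoZ \<rho>" for n
    by (auto simp: rhoZ_def)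
  note F = assms[unfolded inv_filtration_def]
  show "subspace (F (\<rho> * of_int n))" for n
    using F Z by blast
  show "F (\<rho> * of_int n) \<subseteq> F (\<rho> * of_int (n + 1))" for n
    using F Z[of n] by (auto simp: distrib_left)
  show "\<one> \<in> F (\<rho> * of_int 0)"
    using F by simp
  show "zprod V a k b \<in> F (\<rho> * of_int (n + m))"
    if "a \<in> F (\<rho> * of_int n)" "b \<in> F (\<rho> * of_int m)" for a b n m k
    using F Z that by (auto simp: distrib_left)
qed

text \<open>Turns an integer-indexed test filtration into a competitor for the generated one. The
  floor provides a value at every rational; on \<open>rhoZ \<rho>\<close> the quotient is already an
  integer.\<close>

lemma inv_filtration_of_int:
  assumes "invariant_filtration V F" "0 < \<rho>"
  shows "inv_filtration V \<rho> (\<lambda>q. F \<lfloor>q / \<rho>\<rfloor>)"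
proof -
  interpret F: invariant_filtration V F by fact
  have fl: "\<lfloor>(\<rho> * of_int n) / \<rho>\<rfloor> = n" for n
    using assms(2) by simp
  show ?thesis
    unfolding inv_filtration_def rhoZ_def
  proof (intro conjI ballI allI; (elim imageE)?)
    show "F \<lfloor>n / \<rho>\<rfloor> \<subseteq> F \<lfloor>(n + \<rho>) / \<rho>\<rfloor>" for n
      using F.F_Suc[of "\<lfloor>n / \<rho>\<rfloor>"] assms(2) by (simp add: add_divide_distrib)
    show "zprod V a k b \<in> F \<lfloor>(n + m) / \<rho>\<rfloor>"
      if "a \<in> F \<lfloor>n / \<rho>\<rfloor>" "b \<in> F \<lfloor>m / \<rho>\<rfloor>" "n = \<rho> * of_int i" "m = \<rho> * of_int j"
      for a b k n m i j
    proof -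
      have "(n + m) / \<rho> = of_int (i + j)"
        using that(3,4) assms(2) by (simp add: field_simps)
      then show ?thesis
        using F.zprod_F[OF that(1,2)] that(3,4) fl by simp
    qed
  qed (simp_all add: F.subspace_F F.unit_F)
qed

section \<open>Homogeneous components\<close>

lemma graded_mul:
  assumes "graded V \<rho> G" "a \<in> G p" "b \<in> G q"
  shows "a \<cdot> b \<in> G (p + q)"
proof -
  have "zprod V a (- 1) b \<in> G (p + q - of_int (- 1) - 1)"
    using assms unfolding graded_def by blast
  then show ?thesis by (simp add: zprod_minus_one)
qed

lemma graded_trivial: "graded V \<rho> G \<Longrightarrow> q \<notin> rhoN \<rho> \<Longrightarrow> G q = {0}"
  by (simp add: graded_def)

lemma graded_der: "graded V \<rho> G \<Longrightarrow> a \<in> G q \<Longrightarrow> der V a \<in> G (q + 1)"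
  unfolding graded_def by blast

text \<open>Uniqueness in \<open>graded\<close> refers to sums over the exact support; a common
  finite set \<open>A\<close> makes two families comparable without computing their
  supports.\<close>

lemma graded_unique:
  assumes "graded V \<rho> G" "finite A" "\<And>q. f q \<in> G q" "\<And>q. g q \<in> G q"
    and "\<And>q. q \<notin> A \<Longrightarrow> f q = 0" "\<And>q. q \<notin> A \<Longrightarrow> g q = 0"
    and "(\<Sum>q\<in>A. f q) = (\<Sum>q\<in>A. g q)"
  shows "f = g"
proof -
  have sub: "{q. f q \<noteq> 0} \<subseteq> A" "{q. g q \<noteq> 0} \<subseteq> A"
    using assms(5,6) by auto
  then have fin: "finite {q. f q \<noteq> 0}" "finite {q. g q \<noteq> 0}"
    using assms(2) finite_subset by auto
  have "(\<Sum>q | f q \<noteq> 0. f q) = (\<Sum>q\<in>A. f q)" "(\<Sum>q | g q \<noteq> 0. g q) = (\<Sum>q\<in>A. g q)"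
    using sub assms(2) by (auto intro!: sum.mono_neutral_left)
  then have eq: "(\<Sum>q\<in>A. f q) = (\<Sum>q | f q \<noteq> 0. f q)" "(\<Sum>q\<in>A. f q) = (\<Sum>q | g q \<noteq> 0. g q)"
    using assms(7) by simp_all
  define P where
    "P u \<longleftrightarrow> (\<forall>q. u q \<in> G q) \<and> finite {q. u q \<noteq> 0} \<and> (\<Sum>q\<in>A. f q) = (\<Sum>q | u q \<noteq> 0. u q)" for u
  have "\<exists>!u. P u"
    using assms(1) unfolding graded_def P_def by (elim conjE) (erule spec)
  moreover have "P f" "P g"
    unfolding P_def using eq fin assms(3,4) by (simp_all only: simp_thms)
  ultimately show ?thesis
    by blast
qed

lemma graded_decomp:
  assumes "graded V \<rho> G"
  shows "\<exists>f A. finite A \<and> (\<forall>q. f q \<in> G q) \<and> (\<forall>q. q \<notin> A \<longrightarrow> f q = 0) \<and> v = (\<Sum>q\<in>A. f q)"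
proof -
  have "\<exists>!f. (\<forall>q. f q \<in> G q) \<and> finite {q. f q \<noteq> 0} \<and> v = (\<Sum>q | f q \<noteq> 0. f q)"
    using assms unfolding graded_def by (elim conjE) (erule spec)
  then obtain f where "\<forall>q. f q \<in> G q" "finite {q. f q \<noteq> 0}" "v = (\<Sum>q | f q \<noteq> 0. f q)"
    by (elim ex1E conjE)
  then show ?thesis
    by (intro exI[of _ f] exI[of _ "{q. f q \<noteq> 0}"]) simp
qed

lemma graded_subspace: "graded V \<rho> G \<Longrightarrow> subspace (G q)"
  by (simp add: graded_def)

text \<open>Comparing components of weight \<open>k\<close> in \<open>\<one> \<cdot> a = a\<close>
  shows that the component \<open>u 0\<close> of the unit is a left identity on homogeneous vectors.
  Its product with the sum of all components of \<open>\<one>\<close> is then both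
  \<open>u 0\<close> and \<open>\<one>\<close>.\<close>

lemma unit_weight_0:
  assumes G: "graded V \<rho> G"
  shows "\<one> \<in> G 0"
proof -
  obtain u A where dec: "finite A" "\<forall>q. u q \<in> G q" "\<forall>q. q \<notin> A \<longrightarrow> u q = 0" "\<one> = (\<Sum>q\<in>A. u q)"
    using graded_decomp[OF G, of \<one>] by (elim exE conjE)
  note u = dec(1) dec(2)[rule_format] dec(3)[rule_format] dec(4)
  have hom: "u 0 \<cdot> a = a" if a: "a \<in> G k" for a k
  proof -
    define A' where "A' = (\<lambda>q. q + k) ` A"
    \<comment> \<open>\<open>k\<close> is inserted since \<open>0\<close> need not belong to
      \<open>A\<close>.\<close>
    let ?A = "insert k A'"
    have finA': "finite A'"
      using u(1) by (simp add: A'_def)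
    have supp: "u (q - k) = 0" if "q \<notin> A'" for q
    proof (rule u(3), rule notI)
      assume "q - k \<in> A"
      then have "q - k + k \<in> A'" unfolding A'_def by (rule imageI)
      with that show False by simp
    qed
    have "(\<Sum>q\<in>?A. u (q - k) \<cdot> a) = (\<Sum>q\<in>A'. u (q - k) \<cdot> a)"
      using finA' supp by (intro sum.mono_neutral_right) auto
    also have "\<dots> = (\<Sum>q\<in>A. u q \<cdot> a)"
      unfolding A'_def by (subst sum.reindex) (auto simp: inj_on_def)
    also have "\<dots> = (\<Sum>q\<in>A. u q) \<cdot> a"
      by (rule mul_sum_left[symmetric])
    also have "\<dots> = a"
      unfolding u(4)[symmetric] by (rule unit_left)
    also have "\<dots> = (\<Sum>q\<in>?A. if q = k then a else 0)"
      using finA' by simp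
    finally have eq: "(\<Sum>q\<in>?A. u (q - k) \<cdot> a) = (\<Sum>q\<in>?A. if q = k then a else 0)" .
    have "(\<lambda>q. u (q - k) \<cdot> a) = (\<lambda>q. if q = k then a else 0)"
    proof (rule graded_unique[OF G _ _ _ _ _ eq])
      show "finite ?A" using finA' by simp
      show "u (q - k) \<cdot> a \<in> G q" for q
        using graded_mul[OF G u(2) a, of "q - k"] by simp
      show "(if q = k then a else 0) \<in> G q" for q
        using a subspace_0[OF graded_subspace[OF G, of q]] by simp
      show "u (q - k) \<cdot> a = 0" "(if q = k then a else 0) = 0" if "q \<notin> ?A" for q
        using that supp by simp_all
    qed
    from fun_cong[OF this, of k] show ?thesis by simp
  qed
  have "u 0 = u 0 \<cdot> (\<Sum>q\<in>A. u q)"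
    unfolding u(4)[symmetric] by (rule unit_right[symmetric])
  also have "\<dots> = (\<Sum>q\<in>A. u q)"
    by (simp only: mul_sum_right hom[OF u(2)])
  also have "\<dots> = \<one>"
    by (rule u(4)[symmetric])
  finally show ?thesis
    using u(2)[of 0] by simp
qed

text \<open>
  Products and \<open>T\<close> raise the weight at least as much as they raise the filtration degree, so the
  vectors whose components of weight \<open>q\<close> lie in \<open>F q\<close> form a differential subalgebra.
\<close>

lemma graded_subset_filtration:
  assumes G: "graded V \<rho> G" and F: "inv_filtration V \<rho> F"
    and rho: "0 < \<rho>" "inverse \<rho> \<in> \<nat>"
    and S: "\<And>a. a \<in> S \<Longrightarrow> h a \<in> rhoN \<rho> \<and> a \<in> G (h a) \<and> a \<in> F (h a)"
    and gen: "generates_diff_algebra V S" and q: "q \<in> rhoN \<rho>"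
  shows "G q \<subseteq> F q"
proof
  fix v assume v: "v \<in> G q"
  interpret F: invariant_filtration V "\<lambda>n. F (\<rho> * of_int n)"
    by (rule invariant_filtration_of_rat[OF F])
  obtain N where N: "inverse \<rho> = of_nat N"
    using rho(2) by (auto elim: Nats_cases)
  then have N1: "\<rho> * of_nat N = 1"
    using rho(1) by (metis less_numeral_extra(3) right_inverse)
  define B where "B = (\<Union>n::nat. G (\<rho> * of_nat n) \<inter> F (\<rho> * of_nat n))"
  have BI: "a \<in> span B" if "a \<in> G (\<rho> * of_nat n)" "a \<in> F (\<rho> * of_nat n)" for a n
    using that unfolding B_def by (blast intro: span_base)
  have B_mul: "a \<cdot> b \<in> span B" if ab: "a \<in> B" "b \<in> B" for a b
  proof -
    obtain n m where nm: "a \<in> G (\<rho> * of_nat n)" "a \<in> F (\<rho> * of_nat n)"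
        "b \<in> G (\<rho> * of_nat m)" "b \<in> F (\<rho> * of_nat m)"
      using ab unfolding B_def by blast
    have "a \<cdot> b \<in> G (\<rho> * of_nat (n + m))"
      using graded_mul[OF G nm(1,3)] by (simp add: distrib_left)
    moreover have "a \<cdot> b \<in> F (\<rho> * of_nat (n + m))"
      using F.mul_F[of a "int n" b "int m"] nm(2,4) by simp
    ultimately show ?thesis
      by (rule BI)
  qed
  have B_der: "der V a \<in> span B" if a: "a \<in> B" for a
  proof -
    obtain n where n: "a \<in> G (\<rho> * of_nat n)" "a \<in> F (\<rho> * of_nat n)"
      using a unfolding B_def by blast
    have "der V a \<in> G (\<rho> * of_nat (n + N))"
      using graded_der[OF G n(1)] N1 by (simp add: distrib_left)
    \<comment> \<open>The weight goes up by \<open>1 = \<rho> * N\<close> while the filtration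
      degree is kept; monotonicity fills in the \<open>N\<close> steps.\<close>
    moreover have "der V a \<in> F (\<rho> * of_nat (n + N))"
      using F.der_F[of a "int n"] F.F_mono[of "int n" "int (n + N)"] n(2) by auto
    ultimately show ?thesis
      by (rule BI)
  qed
  have span_mul_right: "a \<cdot> b \<in> span B" if "a \<in> B" "b \<in> span B" for a b
    using that(2)
  proof (induction rule: span_induct_alt)
    case (step k x y)
    then show ?case
      using B_mul[OF that(1)] by (simp add: mul_add_right mul_scl_right span_add span_scale)
  qed (simp add: span_zero)
  have "a \<cdot> b \<in> span B" if "a \<in> span B" "b \<in> span B" for a b
    using that(1)
  proof (induction rule: span_induct_alt)
    case (step k x y)
    then show ?case
      using span_mul_right[OF _ that(2)] by (simp add: mul_add_left mul_scl_left span_add span_scale)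
  qed (simp add: span_zero)
  moreover have "der V a \<in> span B" if "a \<in> span B" for a
    using that
  proof (induction rule: span_induct_alt)
    case (step k x y)
    then show ?case
      using B_der by (simp add: der_add der_scl span_add span_scale)
  qed (simp add: span_zero)
  moreover have "\<one> \<in> span B"
    using unit_weight_0[OF G] F.unit_F by (intro BI[of _ 0]) simp_all
  moreover have "S \<subseteq> span B"
  proof
    fix a assume "a \<in> S"
    moreover from this obtain n where "h a = \<rho> * of_nat n"
      using S unfolding rhoN_def by blast
    ultimately show "a \<in> span B"
      using S[of a] BI[of a n] by metis
  qed
  ultimately have "span B = UNIV"
    using gen unfolding generates_diff_algebra_def by simp
  then have "v \<in> span B" by simp
  \<comment> \<open>\<open>F\<close> is unconstrained outside \<open>rhoZ \<rho>\<close>; the value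
    zero off \<open>rhoN \<rho>\<close> makes \<open>GF p\<close> a subspace for every rational
    \<open>p\<close>.\<close>
  define GF where "GF p = (if p \<in> rhoN \<rho> then G p \<inter> F p else {0})" for p
  have GF: "subspace (GF p)" for p
    using F.subspace_F[of "int n" for n] graded_subspace[OF G, of p]
    by (auto simp: GF_def rhoN_def intro!: subspace_inter)
  have "\<exists>f A. finite A \<and> (\<forall>p. f p \<in> GF p) \<and> (\<forall>p. p \<notin> A \<longrightarrow> f p = 0) \<and> v = (\<Sum>p\<in>A. f p)"
    using \<open>v \<in> span B\<close>
  proof (induction rule: span_induct_alt)
    case base
    then show ?case
      using subspace_0[OF GF] by (intro exI[of _ "\<lambda>_. 0"] exI[of _ "{}"]) auto
  next
    case (step k x y)
    then obtain f A where f: "finite A" "\<forall>p. f p \<in> GF p" "\<forall>p. p \<notin> A \<longrightarrow> f p = 0"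
        "y = (\<Sum>p\<in>A. f p)"
      by (elim exE conjE)
    obtain n where "x \<in> G (\<rho> * of_nat n) \<inter> F (\<rho> * of_nat n)"
      using step(1) unfolding B_def by blast
    moreover have "\<rho> * of_nat n \<in> rhoN \<rho>"
      unfolding rhoN_def by blast
    ultimately have x: "x \<in> GF (\<rho> * of_nat n)"
      by (simp add: GF_def)
    let ?n = "\<rho> * of_nat n"
    let ?g = "\<lambda>p. (if p = ?n then k \<odot> x else 0) + f p"
    have "(\<Sum>p\<in>insert ?n A. f p) = y"
      using f by (cases "?n \<in> A") (auto simp: insert_absorb)
    then have "(\<Sum>p\<in>insert ?n A. ?g p) = k \<odot> x + y"
      using f(1) by (simp add: sum.distrib del: sum.insert)
    moreover have "?g p \<in> GF p" for p
      using f(2) x GF[of p] by (auto intro: subspace_add subspace_scale)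
    ultimately show ?case
      using f(1,3) by (intro exI[of _ ?g] exI[of _ "insert ?n A"]) auto
  qed
  then obtain f A where dec: "finite A" "\<forall>p. f p \<in> GF p" "\<forall>p. p \<notin> A \<longrightarrow> f p = 0"
      "v = (\<Sum>p\<in>A. f p)"
    by (elim exE conjE)
  note f = dec(1) dec(2)[rule_format] dec(3)[rule_format] dec(4)
  have eq: "(\<Sum>p\<in>insert q A. f p) = (\<Sum>p\<in>insert q A. if p = q then v else 0)"
    using f(1,3,4) by (cases "q \<in> A") (auto simp: insert_absorb)
  \<comment> \<open>As \<open>v\<close> is homogeneous of weight \<open>q\<close>, uniqueness of
    components identifies it with \<open>f q\<close>, which lies in \<open>F q\<close> by
    construction.\<close>
  have "f = (\<lambda>p. if p = q then v else 0)"
  proof (rule graded_unique[OF G _ _ _ _ _ eq])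
    show "f p \<in> G p" for p
      using f(2)[of p] subspace_0[OF graded_subspace[OF G]] by (auto simp: GF_def split: if_splits)
  qed (use f v subspace_0[OF graded_subspace[OF G]] in auto)
  then show "v \<in> F q"
    using f(2)[of q] q by (simp add: GF_def)
qed

end

section \<open>The two claims for rational degrees\<close>

theorem proposition4p4p5:
  fixes V :: "('k::field_char_0, 'v::ab_group_add) valg"
    and \<rho> :: rat and S :: "'v set" and h :: "'v \<Rightarrow> rat"
  assumes "assoc_unital_vertex_algebra V"
    and "0 < \<rho>" and "inverse \<rho> \<in> \<nat>"
    and "S \<subseteq> parity V False \<union> parity V True"
    and "h ` S \<subseteq> rhoN \<rho>"
  shows "(filtered_generators V \<rho> S h \<longrightarrow> generates_PBW V S) \<and>
    (\<forall>G. graded V \<rho> G \<and> (\<forall>a\<in>S. a \<in> G (h a)) \<and> generates_diff_algebra V S \<longrightarrow>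
       (\<forall>n\<in>rhoZ \<rho>. generated_filtration V \<rho> S h n = standard_filtration V \<rho> G n) \<and>
       filtered_generators V \<rho> S h)"
proof -
  interpret assoc_unital_vertex_algebra V by fact
  let ?F = "generated_filtration V \<rho> S h"
  \<comment> \<open>The weights of generators are multiples of \<open>\<rho>\<close>, so the floor
    is exact on \<open>S\<close>.\<close>
  define H where "H a = \<lfloor>h a / \<rho>\<rfloor>" for a
  have H: "h a = \<rho> * of_int (H a) \<and> 0 \<le> H a" if "a \<in> S" for a
    using assms(2,5) that by (auto simp: H_def rhoN_def)
  have inv: "inv_filtration V \<rho> ?F"
    unfolding generated_filtration_def by (rule inv_filtration_smallest) unfold_locales
  have S_F: "a \<in> ?F (h a)" if "a \<in> S" for a
    using that by (auto simp: generated_filtration_def smallest_filtration_def)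
  interpret F: invariant_filtration V "\<lambda>n. ?F (\<rho> * of_int n)"
    by (rule invariant_filtration_of_rat[OF inv])
  show ?thesis
  proof (intro conjI impI allI)
    assume fg: "filtered_generators V \<rho> S h"
    interpret generated_invariant_filtration V "\<lambda>n. ?F (\<rho> * of_int n)" S H
    proof
      show "S \<subseteq> parity V False \<union> parity V True" by fact
      show "0 \<le> H a" "a \<in> ?F (\<rho> * of_int (H a))" if "a \<in> S" for a
        using H[OF that] S_F[OF that] by simp_all
      show "?F (\<rho> * of_int n) \<subseteq> F' n"
        if "invariant_filtration V F'" "\<And>a. a \<in> S \<Longrightarrow> a \<in> F' (H a)" for F' n
      proof -
        have "inv_filtration V \<rho> (\<lambda>q. F' \<lfloor>q / \<rho>\<rfloor>)"
          by (rule inv_filtration_of_int[OF that(1) assms(2)])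
        moreover have "\<forall>a\<in>S. a \<in> F' \<lfloor>h a / \<rho>\<rfloor>"
          using that(2) by (simp add: H_def)
        ultimately have "?F (\<rho> * of_int n) \<subseteq> F' \<lfloor>\<rho> * of_int n / \<rho>\<rfloor>"
          unfolding generated_filtration_def smallest_filtration_def by blast
        then show ?thesis using assms(2) by simp
      qed
      show "coeff (lbr V a b) t \<in> ?F (\<rho> * of_int (H a + H b - 1))" if "a \<in> S" "b \<in> S" for a b t
      proof -
        have "coeff (lbr V a b) t \<in> ?F (h a + h b - \<rho>)"
          using fg that unfolding filtered_generators_def by blast
        moreover have "h a + h b - \<rho> = \<rho> * of_int (H a + H b - 1)"
          using H that by (simp add: distrib_left right_diff_distrib)
        ultimately show ?thesis by simp
      qed
    qed
    show "generates_PBW V S"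
      using fg by (intro PBW) (simp add: filtered_generators_def)
  next
    fix G
    assume "graded V \<rho> G \<and> (\<forall>a\<in>S. a \<in> G (h a)) \<and> generates_diff_algebra V S"
    then have G: "graded V \<rho> G" and SG: "\<And>a. a \<in> S \<Longrightarrow> a \<in> G (h a)"
      and gen: "generates_diff_algebra V S"
      by auto
    have hN: "h a \<in> rhoN \<rho>" if "a \<in> S" for a
      using that assms(5) by blast
    have GF: "G q \<subseteq> ?F q" if "q \<in> rhoN \<rho>" for q
      by (rule graded_subset_filtration[where h = h, OF G inv assms(2,3) _ gen that]) (simp add: hN SG S_F)
    show "\<forall>n\<in>rhoZ \<rho>. ?F n = standard_filtration V \<rho> G n"
    proof (intro ballI equalityI)
      fix n
      \<comment> \<open>A filtration containing all graded pieces contains the generators in their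
        degrees. Conversely, by \<open>GF\<close>, \<open>?F\<close> is among the filtrations
        intersected in the standard one.\<close>
      show "?F n \<subseteq> standard_filtration V \<rho> G n"
        unfolding generated_filtration_def standard_filtration_def smallest_filtration_def
        using SG hN by blast
      show "standard_filtration V \<rho> G n \<subseteq> ?F n"
        unfolding standard_filtration_def smallest_filtration_def using inv GF by blast
    qed
    have "coeff (lbr V a b) t \<in> ?F (h a + h b - \<rho>)" if ab: "a \<in> S" "b \<in> S" for a b t
    proof -
      obtain N where N: "inverse \<rho> = of_nat N"
        using assms(3) by (auto elim: Nats_cases)
      then have N1: "\<rho> * of_nat N = 1"
        using assms(2) by (metis less_numeral_extra(3) right_inverse)
      then have "1 \<le> N"
        by (cases N) auto
      \<comment> \<open>The weight of \<open>zprod V a (int t) b\<close>. As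
        \<open>\<rho> \<le> 1\<close>, it is at most \<open>h a + h b - \<rho>\<close>; if it is not
        in \<open>rhoN \<rho>\<close>, its graded piece is zero.\<close>
      let ?q = "h a + h b - of_int (int t) - 1"
      have top: "h a + h b - \<rho> = \<rho> * of_int (H a + H b - 1)"
        using H ab by (simp add: distrib_left right_diff_distrib)
      have "?F (h a + h b - \<rho>) \<supseteq> G ?q"
      proof (cases "?q \<in> rhoN \<rho>")
        case True
        then obtain m where m: "?q = \<rho> * of_nat m"
          by (auto simp: rhoN_def)
        have "\<rho> * 1 \<le> \<rho> * of_nat N"
          using assms(2) \<open>1 \<le> N\<close> by (intro mult_left_mono) auto
        then have "?q \<le> h a + h b - \<rho>"
          using N1 by simp
        then have "\<rho> * of_int (int m) \<le> \<rho> * of_int (H a + H b - 1)"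
          using m top by simp
        then have "int m \<le> H a + H b - 1"
          using assms(2) by (simp only: mult_le_cancel_left_pos of_int_le_iff)
        then show ?thesis
          using F.F_mono[of "int m"] GF[OF True] m top by fastforce
      next
        case False
        then show ?thesis
          using graded_trivial[OF G False] subspace_0[OF F.subspace_F, of "H a + H b - 1"]
          unfolding top by simp
      qed
      moreover have "zprod V a (int t) b \<in> G ?q"
        using G SG ab unfolding graded_def by blast
      ultimately have "inverse (fact t) \<odot>\<^bsub>V\<^esub> zprod V a (int t) b \<in> ?F (h a + h b - \<rho>)"
        unfolding top by (blast intro: subspace_scale[OF F.subspace_F])
      then show ?thesis
        by (simp add: zprod_def nprod_def)
    qed
    moreover have "generates_vertex_algebra V S"
      using gen unfolding generates_diff_algebra_def generates_vertex_algebra_def by blast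
    ultimately show "filtered_generators V \<rho> S h"
      by (simp add: filtered_generators_def)
  qed
qed

end
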